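(* Let $X,Y$ be continuous random variables on a common probability space with copula $C_{X,Y}$, and let $U,V$ be invertible copulas (equivalently, copulas with unit Sobolev norm). Let $S_{U,V}(A)=U*A*V$. Then: (1) $X$ and $Y$ are independent if and only if $S_{U,V}(C_{X,Y})=\Pi$. (2) $X$ is completely dependent on $Y$ or $Y$ is completely dependent on $X$ if and only if $S_{U,V}(C_{X,Y})$ is a complete dependence copula. (3) $X$ and $Y$ are mutually completely dependent if and only if $S_{U,V}(C_{X,Y})$ is a mutual complete dependence copula.
   Context: A copula is a function $C\colon[0,1]^2\to[0,1]$ with $C(u,0)=0=C(0,v)$, $C(u,1)=u$, $C(1,v)=v$ and $C(u,v)-C(u,y)-C(x,v)+C(x,y)\ge 0$ whenever $x\le u$, $y\le v$. For continuous random variables $X,Y$ (continuous distribution functions $F,G$) with joint distribution function $H$, $C_{X,Y}$ is the unique copula with $H(x,y)=C_{X,Y}(F(x),G(y))$. The $*$-product is $(C*D)(x,y)=\int_0^1\partial_2C(x,t)\,\partial_1D(t,y)\,dt$, with identity $M(x,y)=\min(x,y)$; $\Pi(x,y)=xy$. A copula $C$ is invertible if there is a copula $D$ with $C*D=M=D*C$. The Sobolev norm is $\|C\|^2=\int_0^1\int_0^1\big((\partial_1C)^2+(\partial_2C)^2\big)\,dx\,dy$; invertibility is known to be equivalent to $\|C\|=1$. $Y$ is completely dependent on $X$ if $Y=h(X)$ almost surely for some Borel measurable $h$. $X$ and $Y$ are mutually completely dependent if $Y=h(X)$ almost surely for some invertible Borel measurable $h$. A complete dependence copula is the copula of two continuous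 random variables one of which is completely dependent on the other; a mutual complete dependence copula is the copula of two mutually completely dependent continuous random variables. *)

theory Defs
  imports "HOL-Probability.Probability"
begin

text \<open>
  A copula is represented by a curried function on all of \<open>real\<close>; only its values on the closed
  unit square are meaningful, and all notions below depend on these values only.  In particular,
  equality of copulas is equality on the unit square.
\<close>

definition copula :: "(real \<Rightarrow> real \<Rightarrow> real) \<Rightarrow> bool" where
  "copula C \<longleftrightarrow>
     (\<forall>u\<in>{0..1}. \<forall>v\<in>{0..1}. C u v \<in> {0..1}) \<and>
     (\<forall>u\<in>{0..1}. C u 0 = 0 \<and> C 0 u = 0 \<and> C u 1 = u \<and> C 1 u = u) \<and>
     (\<forall>x\<in>{0..1}. \<forall>u\<in>{0..1}. \<forall>y\<in>{0..1}. \<forall>v\<in>{0..1}.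
        x \<le> u \<longrightarrow> y \<le> v \<longrightarrow> C u v - C u y - C x v + C x y \<ge> 0)"

definition copula_eq :: "(real \<Rightarrow> real \<Rightarrow> real) \<Rightarrow> (real \<Rightarrow> real \<Rightarrow> real) \<Rightarrow> bool" where
  "copula_eq C D \<longleftrightarrow> (\<forall>x\<in>{0..1}. \<forall>y\<in>{0..1}. C x y = D x y)"

definition min_copula :: "real \<Rightarrow> real \<Rightarrow> real" where
  "min_copula x y = min x y"

definition indep_copula :: "real \<Rightarrow> real \<Rightarrow> real" where
  "indep_copula x y = x * y"

text \<open>
  The sections of a copula are Lipschitz, so the partial derivatives exist almost everywhere.
  At the remaining points of the null set (including the end points, where \<^const>\<open>deriv\<close> would
  look outside the unit square) \<^const>\<open>deriv\<close> has an unspecified value, which does not affect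
  the Lebesgue integral.
\<close>

definition copula_prod ::
  "(real \<Rightarrow> real \<Rightarrow> real) \<Rightarrow> (real \<Rightarrow> real \<Rightarrow> real) \<Rightarrow> real \<Rightarrow> real \<Rightarrow> real" where
  "copula_prod C D x y =
     (LINT t:{0..1}|lebesgue. deriv (\<lambda>s. C x s) t * deriv (\<lambda>s. D s y) t)"

definition invertible_copula :: "(real \<Rightarrow> real \<Rightarrow> real) \<Rightarrow> bool" where
  "invertible_copula C \<longleftrightarrow> copula C \<and>
     (\<exists>D. copula D \<and> copula_eq (copula_prod C D) min_copula
                   \<and> copula_eq (copula_prod D C) min_copula)"

definition copula_S ::
  "(real \<Rightarrow> real \<Rightarrow> real) \<Rightarrow> (real \<Rightarrow> real \<Rightarrow> real) \<Rightarrow> (real \<Rightarrow> real \<Rightarrow> real) \<Rightarrow> real \<Rightarrow> real \<Rightarrow> real" where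
  "copula_S U V A = copula_prod (copula_prod U A) V"

definition continuous_rv :: "'a measure \<Rightarrow> ('a \<Rightarrow> real) \<Rightarrow> bool" where
  "continuous_rv M X \<longleftrightarrow>
     X \<in> borel_measurable M \<and> continuous_on UNIV (cdf (distr M borel X))"

text \<open>
  \<open>is_copula_of M X Y C\<close>: \<open>C\<close> is the copula of \<open>X\<close> and \<open>Y\<close>.  For continuous random variables
  this determines \<open>C\<close> on the unit square.
\<close>

definition is_copula_of ::
  "'a measure \<Rightarrow> ('a \<Rightarrow> real) \<Rightarrow> ('a \<Rightarrow> real) \<Rightarrow> (real \<Rightarrow> real \<Rightarrow> real) \<Rightarrow> bool" where
  "is_copula_of M X Y C \<longleftrightarrow> copula C \<and>
     (\<forall>x y. measure M {\<omega> \<in> space M. X \<omega> \<le> x \<and> Y \<omega> \<le> y}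
            = C (cdf (distr M borel X) x) (cdf (distr M borel Y) y))"

definition completely_dependent_on ::
  "'a measure \<Rightarrow> ('a \<Rightarrow> real) \<Rightarrow> ('a \<Rightarrow> real) \<Rightarrow> bool" where
  "completely_dependent_on M Y X \<longleftrightarrow>
     (\<exists>h :: real \<Rightarrow> real. h \<in> borel_measurable borel \<and> (AE \<omega> in M. Y \<omega> = h (X \<omega>)))"

definition mutually_completely_dependent ::
  "'a measure \<Rightarrow> ('a \<Rightarrow> real) \<Rightarrow> ('a \<Rightarrow> real) \<Rightarrow> bool" where
  "mutually_completely_dependent M X Y \<longleftrightarrow>
     (\<exists>h :: real \<Rightarrow> real. bij h \<and> h \<in> borel_measurable borel \<and> (AE \<omega> in M. Y \<omega> = h (X \<omega>)))"

text \<open>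
  HOL cannot quantify over the type of the underlying probability space inside a formula.  Fixing
  it to be \<open>real \<times> real\<close> loses nothing: random variables on an arbitrary probability space can be
  replaced by the two projections under their joint law.  This is what the two introduction rules
  below state.
\<close>

definition complete_dependence_copula :: "(real \<Rightarrow> real \<Rightarrow> real) \<Rightarrow> bool" where
  "complete_dependence_copula C \<longleftrightarrow>
     (\<exists>(N :: (real \<times> real) measure) X Y. prob_space N \<and> continuous_rv N X \<and> continuous_rv N Y \<and>
        is_copula_of N X Y C \<and> (completely_dependent_on N X Y \<or> completely_dependent_on N Y X))"

definition mutual_complete_dependence_copula :: "(real \<Rightarrow> real \<Rightarrow> real) \<Rightarrow> bool" where
  "mutual_complete_dependence_copula C \<longleftrightarrow>
     (\<exists>(N :: (real \<times> real) measure) X Y. prob_space N \<and> continuous_rv N X \<and> continuous_rv N Y \<and>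
        is_copula_of N X Y C \<and> mutually_completely_dependent N X Y)"

lemma joint_law_transfer:
  fixes X Y :: "'a \<Rightarrow> real"
  assumes M: "prob_space M" and X: "continuous_rv M X" and Y: "continuous_rv M Y"
  defines "N \<equiv> distr M borel (\<lambda>\<omega>. (X \<omega>, Y \<omega>))"
  shows "prob_space N" "continuous_rv N fst" "continuous_rv N snd"
    and "is_copula_of M X Y C \<Longrightarrow> is_copula_of N fst snd C"
    and "completely_dependent_on M X Y \<Longrightarrow> completely_dependent_on N fst snd"
    and "completely_dependent_on M Y X \<Longrightarrow> completely_dependent_on N snd fst"
    and "mutually_completely_dependent M X Y \<Longrightarrow> mutually_completely_dependent N fst snd"
proof -
  interpret prob_space M by fact
  have [measurable]: "X \<in> borel_measurable M" "Y \<in> borel_measurable M"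
    using X Y by (auto simp: continuous_rv_def)
  have [measurable]: "(\<lambda>\<omega>. (X \<omega>, Y \<omega>)) \<in> M \<rightarrow>\<^sub>M borel"
    by (simp add: borel_prod[symmetric])
  have fst_snd [measurable]: "(fst :: real \<times> real \<Rightarrow> real) \<in> borel_measurable borel"
    "(snd :: real \<times> real \<Rightarrow> real) \<in> borel_measurable borel"
    by (simp_all add: borel_prod[symmetric])
  show "prob_space N"
    unfolding N_def by (rule prob_space_distr) measurable
  have d: "distr N borel fst = distr M borel X" "distr N borel snd = distr M borel Y"
    unfolding N_def by (simp_all add: distr_distr o_def)
  show "continuous_rv N fst" "continuous_rv N snd"
    using X Y d fst_snd by (auto simp: continuous_rv_def N_def)
  have joint: "measure N {\<omega> \<in> space N. fst \<omega> \<le> x \<and> snd \<omega> \<le> y}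
      = measure M {\<omega> \<in> space M. X \<omega> \<le> x \<and> Y \<omega> \<le> y}" for x y
  proof -
    have "{\<omega> :: real \<times> real. fst \<omega> \<le> x \<and> snd \<omega> \<le> y} \<in> sets borel" by measurable
    then show ?thesis
      unfolding N_def by (subst measure_distr) (auto intro!: arg_cong[where f = "measure M"])
  qed
  then show "is_copula_of M X Y C \<Longrightarrow> is_copula_of N fst snd C"
    by (simp add: is_copula_of_def d)
  have ae: "(AE \<omega> in N. snd \<omega> = h (fst \<omega>)) \<longleftrightarrow> (AE \<omega> in M. Y \<omega> = h (X \<omega>))"
    "(AE \<omega> in N. fst \<omega> = h (snd \<omega>)) \<longleftrightarrow> (AE \<omega> in M. X \<omega> = h (Y \<omega>))"
    if [measurable]: "h \<in> borel_measurable borel" for h :: "real \<Rightarrow> real"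
    unfolding N_def by (subst AE_distr_iff; simp)+
  show "completely_dependent_on M X Y \<Longrightarrow> completely_dependent_on N fst snd"
    and "completely_dependent_on M Y X \<Longrightarrow> completely_dependent_on N snd fst"
    and "mutually_completely_dependent M X Y \<Longrightarrow> mutually_completely_dependent N fst snd"
    unfolding completely_dependent_on_def mutually_completely_dependent_def
    using ae by blast+
qed

lemma complete_dependence_copulaI:
  fixes X Y :: "'a \<Rightarrow> real"
  assumes "prob_space M" "continuous_rv M X" "continuous_rv M Y" "is_copula_of M X Y C"
    and "completely_dependent_on M X Y \<or> completely_dependent_on M Y X"
  shows "complete_dependence_copula C"
  unfolding complete_dependence_copula_def
  using assms joint_law_transfer[OF assms(1-3)] by metis

lemma mutual_complete_dependence_copulaI:
  fixes X Y :: "'a \<Rightarrow> real"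
  assumes "prob_space M" "continuous_rv M X" "continuous_rv M Y" "is_copula_of M X Y C"
    and "mutually_completely_dependent M X Y"
  shows "mutual_complete_dependence_copula C"
  unfolding mutual_complete_dependence_copula_def
  using assms joint_law_transfer[OF assms(1-3)] by metis

end

theory Submission
  imports Defs
begin

text \<open>
The idea is that multiplying by invertible copulas only reshuffles the two variables separately.
For \<open>P = F \<circ> X\<close> and \<open>Q = G \<circ> Y\<close>, with \<open>F\<close> and \<open>G\<close> the distribution functions of \<open>X\<close> and \<open>Y\<close>,
the copula \<open>C\<close> is the joint distribution function of the uniform variables \<open>P\<close> and \<open>Q\<close>.  An
invertible copula \<open>U\<close> comes from a measure-preserving map \<open>\<phi>\<close> of the unit interval that is
invertible almost everywhere, in the sense that \<open>\<partial>\<^sub>2 U(x, t)\<close> is the indicator of \<open>\<phi> t \<le> x\<close>.  As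
\<open>\<partial>\<^sub>1 C(t, y)\<close> is the conditional probability of \<open>Q \<le> y\<close> given \<open>P = t\<close>, the integral defining
\<open>U * C\<close> is the probability that \<open>\<phi> \<circ> P \<le> x\<close> and \<open>Q \<le> y\<close>.  So \<open>U * C\<close> is the copula of
\<open>(\<phi> \<circ> P, Q)\<close>, and by transposition \<open>U * C * V\<close> is the copula of a pair \<open>(X', Y')\<close> in which \<open>X'\<close>
and \<open>X\<close> are Borel functions of each other almost surely, and so are \<open>Y'\<close> and \<open>Y\<close>
(\<open>copula_S_representation\<close>).

All three kinds of dependence are insensitive to such a replacement of the variables.  Moreover the
copula of a pair of uniform variables is their joint distribution function, hence determines their
joint law, and so whether they are independent or functions of each other.  This gives the three
equivalences.

Three facts are needed on the way.  The product is defined through pointwise derivatives, so the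
sections of a copula have to be differentiable almost everywhere and have to be the integrals of
their derivatives (\<open>lipschitz_mono_density\<close>).  That invertible copulas come from measure-preserving
maps rests on the inequalities \<open>0 \<le> \<partial>C \<le> 1\<close>: if \<open>(U * D)(x, x) = x\<close>, then the functions
\<open>a = \<partial>\<^sub>2 U(x, \<cdot>)\<close> and \<open>b = \<partial>\<^sub>1 D(\<cdot>, x)\<close> have the same integral \<open>x\<close> as their product, which forces
\<open>a = a b = b\<close>, so \<open>a\<close> takes only the values \<open>0\<close> and \<open>1\<close> (\<open>inverse_section_zero_one\<close>).  Finally,
mutual complete dependence asks for a bijection of the whole real line, whereas two variables that
are functions of each other only give a bijection between sets of full measure; the exceptional
sets are made isomorphic by a Schroeder-Bernstein argument
(\<open>mutually_completely_dependentI\<close>).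
\<close>

section \<open>Differentiation of monotone Lipschitz functions\<close>

text \<open>
On short intervals \<open>I\<close> around the points of this set the increment of \<open>f\<close>, which is the integral of
\<open>g\<close>, exceeds \<open>b |I|\<close>.  A disjoint family of such intervals covers almost all of the set by Vitali's
theorem, and it can be chosen inside an open set that barely exceeds \<open>{g < a}\<close>.  There the integral
of \<open>g\<close> over the union \<open>W\<close> is at most \<open>a |W|\<close> plus a small error, so \<open>(b - a) |W|\<close> is small.
\<close>

lemma negligible_upper_derivative_gt:
  fixes g :: "real \<Rightarrow> real"
  assumes g [measurable]: "g \<in> borel_measurable borel" and g01: "\<And>t. 0 \<le> g t \<and> g t \<le> 1"
    and I: "\<And>a b. a \<le> b \<Longrightarrow> emeasure (density lborel g) {a..b} = ennreal (f b - f a)"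
    and a: "0 \<le> a" and ab: "a < b"
  shows "negligible {t. g t < a \<and> (\<forall>d>0. \<exists>u v. u < v \<and> u \<le> t \<and> t \<le> v \<and> v - u < d \<and> f v - f u > b * (v - u))}"
    (is "negligible ?S")
proof -
  have bdd: "negligible (?S \<inter> {-real n<..<real n})" for n
    unfolding negligible_outer_le
  proof safe
    fix e :: real assume e: "0 < e"
    define S' where "S' = ?S \<inter> {-real n<..<real n}"
    define A where "A = {t. g t < a}"
    have A[measurable]: "A \<in> sets borel" unfolding A_def by measurable
    \<comment> \<open>The error \<open>(b - a) e\<close> is chosen so that the final bound on the measure is \<open>e\<close>.\<close>
    obtain T0 where T0: "open T0" "A \<subseteq> T0" "emeasure lborel (T0 - A) < (b - a) * e"
      using outer_regular_lborel[OF A, of "(b - a) * e"] ab e by auto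
    then have [measurable]: "T0 \<in> sets borel" by simp
    define T where "T = T0 \<inter> {-real n<..<real n}"
    have T: "open T" unfolding T_def using T0 by auto
    then have [measurable]: "T \<in> sets borel" by simp
    have ST: "S' \<subseteq> T" using T0 by (auto simp: T_def A_def S'_def)
    have Tfin: "emeasure lborel T < \<infinity>"
    proof -
      have "emeasure lborel T \<le> emeasure lborel {-real n<..<real n}"
        by (rule emeasure_mono) (auto simp: T_def)
      then show ?thesis using le_less_trans by fastforce
    qed
    define K where "K = {(c, r). 0 < r \<and> cball c r \<subseteq> T \<and> f (c + r) - f (c - r) > b * (2 * r)}"
    have cov: "\<exists>i. i \<in> K \<and> x \<in> cball (fst i) (snd i) \<and> snd i < d" if x: "x \<in> S'" and d: "0 < d" for x d
    proof -
      obtain r where r: "0 < r" "cball x r \<subseteq> T"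
        using T ST x open_contains_cball by blast
      obtain u v where uv: "u < v" "u \<le> x" "x \<le> v" "v - u < min d r" "f v - f u > b * (v - u)"
        using x r(1) d unfolding S'_def by (auto dest: spec[of _ "min d r"])
      have cb: "cball ((u+v)/2) ((v-u)/2) = {u..v}"
        by (simp add: cball_eq_atLeastAtMost field_simps)
      also have "\<dots> \<subseteq> cball x r" using uv by (auto simp: dist_real_def)
      finally have "((u+v)/2, (v-u)/2) \<in> K"
        unfolding K_def using uv r by (auto simp: field_simps)
      then show ?thesis using uv cb by (intro exI[of _ "((u+v)/2, (v-u)/2)"]) auto
    qed
    have K0: "0 < snd i" if "i \<in> K" for i using that by (auto simp: K_def)
    obtain C where C: "countable C" "C \<subseteq> K"
       "pairwise (\<lambda>i j. disjnt (cball (fst i) (snd i)) (cball (fst j) (snd j))) C"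
       "negligible (S' - (\<Union>i\<in>C. cball (fst i) (snd i)))"
      using Vitali_covering_theorem_cballs[of K snd S' fst, OF _ cov] K0 by blast
    define W where "W = (\<Union>i\<in>C. cball (fst i) (snd i))"
    have WT: "W \<subseteq> T" using C(2) by (fastforce simp: W_def K_def)
    have [measurable]: "W \<in> sets borel" unfolding W_def using C(1) by (auto intro: sets.countable_UN')
    have disj: "disjoint_family_on (\<lambda>i. cball (fst i) (snd i)) C"
      using C(3) by (force simp: disjoint_family_on_def pairwise_def disjnt_def)
    have Wfin: "emeasure lborel W < \<infinity>"
      using Tfin by (rule order.strict_trans1[rotated]) (auto intro!: emeasure_mono WT)
    define w where "w = measure lborel W"
    have w: "emeasure lborel W = ennreal w" unfolding w_def using Wfin
      by (simp add: emeasure_eq_ennreal_measure)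
    have b1: "ennreal b * emeasure lborel W \<le> emeasure (density lborel g) W"
    proof -
      have "ennreal b * emeasure lborel W = (\<integral>\<^sup>+i. ennreal b * emeasure lborel (cball (fst i) (snd i)) \<partial>count_space C)"
        unfolding W_def by (subst emeasure_UN_countable) (auto simp: disj C nn_integral_cmult)
      also have "\<dots> \<le> (\<integral>\<^sup>+i. emeasure (density lborel g) (cball (fst i) (snd i)) \<partial>count_space C)"
      proof (rule nn_integral_mono)
        fix i assume "i \<in> space (count_space C)"
        then have "i \<in> K" using C by auto
        then have i: "0 < snd i" "f (fst i + snd i) - f (fst i - snd i) > b * (2 * snd i)"
          by (auto simp: K_def)
        have "ennreal b * emeasure lborel (cball (fst i) (snd i)) = ennreal (b * (2 * snd i))"
          using i by (cases "b \<ge> 0") (auto simp: cball_eq_atLeastAtMost ennreal_mult ennreal_neg mult_le_0_iff)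
        also have "\<dots> \<le> ennreal (f (fst i + snd i) - f (fst i - snd i))"
          using i by (intro ennreal_leI) auto
        also have "\<dots> = emeasure (density lborel g) (cball (fst i) (snd i))"
          using i by (subst I[symmetric]) (auto simp: cball_eq_atLeastAtMost)
        finally show "ennreal b * emeasure lborel (cball (fst i) (snd i)) \<le> emeasure (density lborel g) (cball (fst i) (snd i))" .
      qed
      also have "\<dots> = emeasure (density lborel g) W"
        unfolding W_def by (subst emeasure_UN_countable) (auto simp: disj C)
      finally show ?thesis .
    qed
    have b2: "emeasure (density lborel g) W \<le> ennreal a * emeasure lborel W + ennreal ((b-a)*e)"
    proof -
      have "emeasure (density lborel g) W = (\<integral>\<^sup>+t. ennreal (g t) * indicator W t \<partial>lborel)"
        by (subst emeasure_density) auto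
      also have "\<dots> \<le> (\<integral>\<^sup>+t. ennreal a * indicator W t + indicator (T0 - A) t \<partial>lborel)"
      proof (rule nn_integral_mono)
        fix t
        show "ennreal (g t) * indicator W t \<le> ennreal a * indicator W t + indicator (T0 - A) t"
          using g01[of t] WT by (cases "t \<in> A") (auto simp: A_def T_def indicator_def intro!: ennreal_leI add_increasing)
      qed
      also have "\<dots> = ennreal a * emeasure lborel W + emeasure lborel (T0 - A)"
        by (subst nn_integral_add) (auto simp: nn_integral_cmult)
      also have "\<dots> \<le> ennreal a * emeasure lborel W + ennreal ((b-a)*e)"
        using T0(3) by (intro add_left_mono) auto
      finally show ?thesis .
    qed
    have "w \<le> e"
    proof -
      have "0 \<le> w" by (simp add: w_def)
      then have "ennreal (b * w) \<le> ennreal (a * w + (b - a) * e)"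
        using b1 b2 a ab e unfolding w by (simp add: ennreal_mult ennreal_plus)
      then have "b * w \<le> a * w + (b - a) * e"
        using a ab e \<open>0 \<le> w\<close> by (subst (asm) ennreal_le_iff) auto
      then have "(b - a) * w \<le> (b - a) * e" by (simp add: algebra_simps)
      then show ?thesis using ab by simp
    qed
    show "\<exists>T. ?S \<inter> {-real n<..<real n} \<subseteq> T \<and> T \<in> lmeasurable \<and> measure lebesgue T \<le> e"
      unfolding S'_def[symmetric]
    proof (intro exI conjI)
      show "S' \<subseteq> W \<union> (S' - W)" by auto
      have Wl: "W \<in> lmeasurable" using Wfin by (auto simp: fmeasurable_def)
      have N: "S' - W \<in> null_sets lebesgue" using C(4) unfolding W_def negligible_iff_null_sets .
      show "W \<union> (S' - W) \<in> lmeasurable"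
        using Wl N by (meson fmeasurable.Un negligible_iff_null_sets negligible_imp_measurable)
      have "measure lebesgue (W \<union> (S' - W)) = measure lebesgue W"
        using Wl N by (intro measure_Un_null_set) auto
      then show "measure lebesgue (W \<union> (S' - W)) \<le> e"
        using \<open>w \<le> e\<close> by (simp add: w_def)
    qed
  qed
  have "?S \<subseteq> (\<Union>n. ?S \<inter> {-real n<..<real n})"
  proof
    fix x assume "x \<in> ?S"
    moreover obtain n where "\<bar>x\<bar> < real n" using reals_Archimedean2 by blast
    ultimately show "x \<in> (\<Union>n. ?S \<inter> {-real n<..<real n})" by (auto intro!: exI[of _ n])
  qed
  then show ?thesis
    using bdd by (meson negligible_countable_Union negligible_subset countable_UN negligible_Union_nat)
qed


text \<open>
Lebesgue's differentiation theorem for a density with values in the unit interval.  The preceding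
lemma bounds the difference quotients of \<open>f\<close> from above; the bound from below is the same statement
for \<open>x - f x\<close>, whose density is \<open>1 - g\<close>.
\<close>

lemma AE_has_derivative_of_density:
  fixes g :: "real \<Rightarrow> real"
  assumes g [measurable]: "g \<in> borel_measurable borel" and g01: "\<And>t. 0 \<le> g t \<and> g t \<le> 1"
    and I: "\<And>a b. a \<le> b \<Longrightarrow> emeasure (density lborel g) {a..b} = ennreal (f b - f a)"
    and mono: "mono f"
  shows "AE t in lborel. (f has_real_derivative g t) (at t)"
proof -
  define B where "B f g a b = {t. g t < a \<and> (\<forall>d>0. \<exists>u v. u < v \<and> u \<le> t \<and> t \<le> v \<and> v - u < d \<and> f v - f u > b * (v - u))}"
    for f g :: "real \<Rightarrow> real" and a b
  define f' where "f' x = x - f x" for x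
  define g' where "g' x = 1 - g x" for x
  have [measurable]: "g' \<in> borel_measurable borel" unfolding g'_def by measurable
  have I': "emeasure (density lborel g') {a..b} = ennreal (f' b - f' a)" if "a \<le> b" for a b
  proof -
    have "emeasure (density lborel g) {a..b} + emeasure (density lborel g') {a..b}
        = (\<integral>\<^sup>+t. ennreal (g t) * indicator {a..b} t + ennreal (g' t) * indicator {a..b} t \<partial>lborel)"
      by (simp add: emeasure_density nn_integral_add)
    also have "\<dots> = (\<integral>\<^sup>+t. indicator {a..b} t \<partial>lborel)"
      using g01 by (intro nn_integral_cong) (auto simp: g'_def indicator_def ennreal_plus[symmetric] simp del: ennreal_plus)
    also have "\<dots> = ennreal (b - a)" using that by simp
    also have "\<dots> = ennreal (f b - f a) + ennreal (b - a - (f b - f a))"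
    proof -
      have "ennreal (f b - f a) = (\<integral>\<^sup>+t. ennreal (g t) * indicator {a..b} t \<partial>lborel)"
        unfolding I[OF that, symmetric] by (subst emeasure_density) auto
      also have "\<dots> \<le> (\<integral>\<^sup>+t. indicator {a..b} t \<partial>lborel)"
        using g01 by (intro nn_integral_mono) (auto simp: indicator_def)
      also have "\<dots> = ennreal (b - a)" using that by simp
      finally have "ennreal (f b - f a) \<le> ennreal (b - a)" .
      then have "f b - f a \<le> b - a" using that by (auto simp: ennreal_le_iff2)
      moreover have "f a \<le> f b" using mono that by (auto dest: monoD)
      ultimately show ?thesis by (subst ennreal_plus[symmetric]) auto
    qed
    finally show ?thesis unfolding I[OF that] f'_def
      by (simp add: algebra_simps)
  qed
  have g'01: "0 \<le> g' t \<and> g' t \<le> 1" for t using g01[of t] by (auto simp: g'_def)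
  define E where "E a b = (if 0 \<le> a \<and> a < b then B f g a b \<union> B f' g' a b else {})" for a b
  define N where "N = (\<Union>a\<in>\<rat>. \<Union>b\<in>\<rat>. E a b)"
  have "negligible N"
  proof -
    have "negligible (E a b)" for a b
      using negligible_upper_derivative_gt[OF g g01 I, of a b]
          negligible_upper_derivative_gt[of g', OF _ g'01 I', of a b]
      unfolding E_def B_def by (auto intro!: negligible_Un)
    then show ?thesis unfolding N_def
      by (auto intro!: negligible_countable_Union countable_image countable_rat)
  qed
  then have "AE t in lebesgue. t \<notin> N"
    by (auto simp: negligible_iff_null_sets intro: AE_not_in)
  then have ae: "AE t in lborel. t \<notin> N"
    by (simp add: AE_completion_iff)
  have up: "\<exists>d>0. \<forall>u v. u < v \<longrightarrow> u \<le> t \<longrightarrow> t \<le> v \<longrightarrow> v - u < d \<longrightarrow> h v - h u \<le> (k t + e) * (v - u)"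
    if e: "e > 0" and k: "0 \<le> k t" and nB: "\<And>a b. a \<in> \<rat> \<Longrightarrow> b \<in> \<rat> \<Longrightarrow> 0 \<le> a \<Longrightarrow> a < b \<Longrightarrow> t \<notin> B h k a b" for h k e t
  proof -
    obtain a where a: "a \<in> \<rat>" "k t < a" "a < k t + e" using Rats_dense_in_real[of "k t" "k t + e"] e by auto
    obtain b where b: "b \<in> \<rat>" "a < b" "b < k t + e" using Rats_dense_in_real[of a "k t + e"] a by auto
    have "t \<notin> B h k a b" using nB a b k by auto
    then obtain d where "d > 0" and d: "\<And>u v. u < v \<Longrightarrow> u \<le> t \<Longrightarrow> t \<le> v \<Longrightarrow> v - u < d \<Longrightarrow> \<not> h v - h u > b * (v - u)"
      using a by (auto simp: B_def)
    show ?thesis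
    proof (intro exI conjI allI impI)
      fix u v assume *: "u < v" "u \<le> t" "t \<le> v" "v - u < d"
      have "h v - h u \<le> b * (v - u)" using d[OF *] by simp
      also have "\<dots> \<le> (k t + e) * (v - u)" using * b by (intro mult_right_mono) auto
      finally show "h v - h u \<le> (k t + e) * (v - u)" .
    qed fact
  qed
  have D: "(f has_real_derivative g t) (at t)" if t: "t \<notin> N" for t
    unfolding DERIV_def LIM_eq
  proof (intro allI impI)
    fix r :: real assume "r > 0"
    define e where "e = r / 2"
    have e: "e > 0" using \<open>r > 0\<close> by (simp add: e_def)
    \<comment> \<open>Small intervals around \<open>t\<close> have slopes at most \<open>g t + e\<close>, and at least \<open>g t - e\<close> by \<open>d2\<close>.\<close>
    obtain d1 where d1: "d1 > 0" "\<And>u v. u < v \<Longrightarrow> u \<le> t \<Longrightarrow> t \<le> v \<Longrightarrow> v - u < d1 \<Longrightarrow> f v - f u \<le> (g t + e) * (v - u)"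
      using up[OF e, of g t f] g01[of t] t unfolding N_def E_def by (auto; metis)
    obtain d2 where d2: "d2 > 0" "\<And>u v. u < v \<Longrightarrow> u \<le> t \<Longrightarrow> t \<le> v \<Longrightarrow> v - u < d2 \<Longrightarrow> f' v - f' u \<le> (g' t + e) * (v - u)"
      using up[OF e, of g' t f'] g'01[of t] t unfolding N_def E_def by (auto; metis)
    have bound: "\<bar>f v - f u - g t * (v - u)\<bar> \<le> e * (v - u)" 
      if "u < v" "u \<le> t" "t \<le> v" "v - u < min d1 d2" for u v
      using d1(2)[of u v] d2(2)[of u v] that by (auto simp: f'_def g'_def algebra_simps abs_le_iff)
    show "\<exists>s>0. \<forall>x. x \<noteq> 0 \<and> norm (x - 0) < s \<longrightarrow> norm ((f (t + x) - f t) / x - g t) < r"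
    proof (intro exI[of _ "min d1 d2"] conjI allI impI)
      fix x :: real assume x: "x \<noteq> 0 \<and> norm (x - 0) < min d1 d2"
      have "\<bar>f (t + x) - f t - g t * x\<bar> \<le> e * \<bar>x\<bar>"
      proof (cases "x > 0")
        case True then show ?thesis using bound[of t "t + x"] x by auto
      next
        case False
        then have "\<bar>f t - f (t + x) - g t * (- x)\<bar> \<le> e * (- x)"
          using bound[of "t + x" t] x by auto
        then show ?thesis using False by (simp add: abs_if algebra_simps split: if_splits)
      qed
      moreover have "(f (t + x) - f t) / x - g t = (f (t + x) - f t - g t * x) / x"
        using x by (simp add: field_simps)
      ultimately have "norm ((f (t + x) - f t) / x - g t) \<le> e"
        using x by (simp add: field_simps)
      then show "norm ((f (t + x) - f t) / x - g t) < r" using \<open>r > 0\<close> by (simp add: e_def)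
    qed (use d1 d2 in auto)
  qed
  show ?thesis using ae by eventually_elim (rule D)
qed

lemma continuous_on_lipschitz_mono:
  fixes f :: "real \<Rightarrow> real"
  assumes mono: "mono f" and lip: "\<And>x y. x \<le> y \<Longrightarrow> f y - f x \<le> y - x"
  shows "continuous_on UNIV f"
proof (rule continuous_onI)
  fix x e :: real assume "0 < e"
  then show "\<exists>d>0. \<forall>x'\<in>UNIV. dist x' x < d \<longrightarrow> dist (f x') (f x) \<le> e"
    using lip mono by (intro exI[of _ e]) (auto simp: dist_real_def abs_if mono_def, smt+)
qed

text \<open>
The Stieltjes measures of \<open>f\<close> and of \<open>x - f x\<close> are both measures because \<open>f\<close> is monotone and
1-Lipschitz, and they add up to Lebesgue measure.  So both are absolutely continuous, and their
densities add up to \<open>1\<close>.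
\<close>

lemma interval_measure_has_density:
  fixes f :: "real \<Rightarrow> real"
  assumes mono: "mono f" and lip: "\<And>x y. x \<le> y \<Longrightarrow> f y - f x \<le> y - x"
  obtains g where "g \<in> borel_measurable borel" "\<And>t. 0 \<le> g t \<and> g t \<le> 1"
    "interval_measure f = density lborel (\<lambda>t. ennreal (g t))"
proof -
  define f' where "f' x = x - f x" for x
  have incr: "\<And>x y. x \<le> y \<Longrightarrow> f x \<le> f y" "\<And>x y. x \<le> y \<Longrightarrow> f' x \<le> f' y"
    using mono lip by (auto simp: f'_def monoD algebra_simps)
  have cont: "continuous_on UNIV f" by (rule continuous_on_lipschitz_mono[OF assms])
  then have cont': "continuous_on UNIV f'" unfolding f'_def by (intro continuous_intros)
  have rc: "continuous (at_right a) f" "continuous (at_right a) f'" for a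
    using cont cont' by (auto simp: continuous_on_eq_continuous_within intro: continuous_within_subset)
  let ?N = "interval_measure f" and ?N' = "interval_measure f'"
  define S where "S = measure_of UNIV (sets borel) (\<lambda>A. emeasure ?N A + emeasure ?N' A)"
  have sets_S: "sets S = sets borel" unfolding S_def by (metis sets.sigma_sets_eq sets_measure_of space_borel subset_Pow_Union sets.space_closed)
  have em_S: "emeasure S A = emeasure ?N A + emeasure ?N' A" if "A \<in> sets borel" for A
  proof (rule emeasure_measure_of[OF S_def])
    show "positive (sets S) (\<lambda>A. emeasure ?N A + emeasure ?N' A)" by (auto simp: positive_def)
    show "countably_additive (sets S) (\<lambda>A. emeasure ?N A + emeasure ?N' A)"
      unfolding countably_additive_def sets_S
      by (auto simp: suminf_add[symmetric] suminf_emeasure)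
  qed (use that sets_S in auto)
  have Ioc: "emeasure S {a<..b} = emeasure lborel {a<..b}" for a b
  proof (cases "a \<le> b")
    case True
    then show ?thesis
      by (simp add: em_S emeasure_interval_measure_Ioc incr rc ennreal_plus[symmetric] del: ennreal_plus)
        (simp add: f'_def)
  qed (simp add: em_S)
  have S: "S = lborel"
  proof (rule measure_eqI_generator_eq[where \<Omega>=UNIV and E="range (\<lambda>(a, b). {a<..b::real})" and A="\<lambda>i. {- real i<..real i}"])
    show "(\<Union>i. {- real (i::nat)<..real i}) = UNIV" by (rule UN_Ioc_eq_UNIV)
  qed (auto simp: sets_S borel_sigma_sets_Ioc Int_stable_def Ioc)
  have le: "emeasure ?N A \<le> emeasure lborel A" "emeasure ?N' A \<le> emeasure lborel A" if "A \<in> sets borel" for A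
    using em_S[OF that] unfolding S by auto
  have "absolutely_continuous lborel ?N" "absolutely_continuous lborel ?N'"
    unfolding absolutely_continuous_def using le by (auto simp: null_sets_def) (metis le le_zero_eq)+
  then obtain h h' where h [measurable]: "h \<in> borel_measurable lborel" "h' \<in> borel_measurable lborel"
    and hd: "density lborel h = ?N" "density lborel h' = ?N'"
    using sigma_finite_measure.Radon_Nikodym[OF sigma_finite_lborel, of ?N] sigma_finite_measure.Radon_Nikodym[OF sigma_finite_lborel, of ?N'] by auto
  have "density lborel (\<lambda>t. h t + h' t) = density lborel (\<lambda>t. 1)"
  proof (rule measure_eqI)
    fix A assume "A \<in> sets (density lborel (\<lambda>t. h t + h' t))"
    then have [measurable]: "A \<in> sets borel" by simp
    have "emeasure (density lborel (\<lambda>t. h t + h' t)) A = emeasure (density lborel h) A + emeasure (density lborel h') A"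
      by (simp add: emeasure_density distrib_right nn_integral_add)
    also have "\<dots> = emeasure lborel A" unfolding hd using em_S[of A] S by simp
    finally show "emeasure (density lborel (\<lambda>t. h t + h' t)) A = emeasure (density lborel (\<lambda>t. 1)) A"
      by (simp add: emeasure_density)
  qed simp
  then have "AE t in lborel. h t + h' t = 1"
    by (intro sigma_finite_measure.density_unique[OF sigma_finite_lborel]) auto
  then have ae: "AE t in lborel. h t \<le> 1"
    by eventually_elim (metis le_iff_add)
  show thesis
  \<comment> \<open>The density is at most \<open>1\<close> almost everywhere; truncation makes this hold everywhere.\<close>
  proof (rule that[of "\<lambda>t. enn2real (min 1 (h t))"])
    show "(\<lambda>t. enn2real (min 1 (h t))) \<in> borel_measurable borel" using h by measurable
    have m: "min 1 (h t) < top" for t by (rule le_less_trans[of _ 1]) auto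
    have mm: "ennreal (enn2real (min 1 (h t))) = min 1 (h t)" for t
      using m[of t] by simp
    show "0 \<le> enn2real (min 1 (h t)) \<and> enn2real (min 1 (h t)) \<le> 1" for t
      by (simp add: enn2real_leI)
    show "interval_measure f = density lborel (\<lambda>t. ennreal (enn2real (min 1 (h t))))"
      unfolding hd[symmetric] mm using ae
      by (intro density_cong) (auto simp: min_def)
  qed
qed

lemma lipschitz_mono_density:
  fixes f :: "real \<Rightarrow> real"
  assumes mono: "mono f" and lip: "\<And>x y. x \<le> y \<Longrightarrow> f y - f x \<le> y - x"
  obtains g where "g \<in> borel_measurable borel" "\<And>t. 0 \<le> g t \<and> g t \<le> 1"
    "\<And>a b. a \<le> b \<Longrightarrow> emeasure (density lborel (\<lambda>t. ennreal (g t))) {a..b} = ennreal (f b - f a)"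
    "AE t in lborel. (f has_real_derivative g t) (at t)"
proof -
  obtain g where g: "g \<in> borel_measurable borel" "\<And>t. 0 \<le> g t \<and> g t \<le> 1"
    "interval_measure f = density lborel (\<lambda>t. ennreal (g t))"
    using interval_measure_has_density[OF assms] by blast
  have cont: "continuous_on UNIV f" by (rule continuous_on_lipschitz_mono[OF assms])
  have I: "emeasure (density lborel (\<lambda>t. ennreal (g t))) {a..b} = ennreal (f b - f a)" if "a \<le> b" for a b
    unfolding g(3)[symmetric] using that mono cont
    by (subst emeasure_interval_measure_Icc) (auto intro: monoD)
  show thesis
    using that[OF g(1,2) I AE_has_derivative_of_density[OF g(1,2) I mono]] by blast
qed

section \<open>The uniform law and the sections of a copula\<close>

text \<open>
The open interval is used because copula sections are differentiated in its interior only and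
because quantile functions are finite exactly there.
\<close>

definition unif :: "real measure" where
  "unif = density lborel (\<lambda>t. ennreal (indicator {0<..<1} t))"

lemma sets_unif [simp, measurable_cong]: "sets unif = sets borel"
  and space_unif [simp]: "space unif = UNIV"
  by (simp_all add: unif_def)

lemma emeasure_unif: "A \<in> sets borel \<Longrightarrow> emeasure unif A = emeasure lborel ({0<..<1} \<inter> A)"
  by (simp add: unif_def emeasure_density ennreal_indicator indicator_inter_arith[symmetric])

lemma prob_space_unif: "prob_space unif"
  by (rule prob_spaceI) (simp add: emeasure_unif)

lemma AE_unif: "(AE t in unif. P t) \<longleftrightarrow> (AE t in lborel. 0 < t \<and> t < 1 \<longrightarrow> P t)"
  unfolding unif_def by (subst AE_density) (auto simp: indicator_def)

lemma measure_unif_atMost: "measure unif {..u} = max 0 (min 1 u)"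
proof -
  have "emeasure unif {..u} = emeasure lborel ({0<..<1} \<inter> {..u})" by (simp add: emeasure_unif)
  also have "{0<..<1} \<inter> {..u} = (if u \<le> 0 then {} else if 1 \<le> u then {0<..<1} else {0<..u})"
    by auto
  also have "emeasure lborel \<dots> = ennreal (max 0 (min 1 u))"
    by (auto simp: max_def min_def)
  finally have e: "emeasure unif {..u} = ennreal (max 0 (min 1 u))" .
  show ?thesis unfolding measure_def e by (rule enn2real_ennreal) simp
qed

lemma cdf_unif: "cdf unif u = max 0 (min 1 u)"
  by (simp add: cdf_def measure_unif_atMost)

lemma real_distribution_unif: "real_distribution unif"
proof -
  interpret prob_space unif by (rule prob_space_unif)
  show ?thesis by standard simp_all
qed

lemma copula_transpose:
  assumes C: "copula C" shows "copula (\<lambda>x y. C y x)"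
  unfolding copula_def
proof (intro conjI ballI impI)
  fix x u y v :: real assume "x \<in> {0..1}" "u \<in> {0..1}" "y \<in> {0..1}" "v \<in> {0..1}" "x \<le> u" "y \<le> v"
  then have "C v u - C v x - C y u + C y x \<ge> 0" using C unfolding copula_def by blast
  then show "C v u - C y u - C v x + C y x \<ge> 0" by simp
qed (use C in \<open>auto simp: copula_def\<close>)

text \<open>
Brings the integrals that define the copula product into the probabilistic form.  The integrand
\<open>h\<close>, a product of pointwise derivatives, is only known to agree almost everywhere with a Borel
function.
\<close>

lemma lebesgue_unit_integral_eq_unif:
  fixes h k :: "real \<Rightarrow> real"
  assumes k [measurable]: "k \<in> borel_measurable borel" and ae: "AE t in unif. h t = k t"
  shows "(LINT t:{0..1}|lebesgue. h t) = (LINT t|unif. k t)"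
proof -
  have "AE t in lborel. t \<noteq> 0" "AE t in lborel. t \<noteq> (1::real)" by (rule AE_lborel_singleton)+
  with ae have "AE t in lborel. indicator {0<..<1} t *\<^sub>R k t = indicator {0..1} t *\<^sub>R h t"
    unfolding AE_unif by eventually_elim (auto simp: indicator_def)
  then have ae': "AE t in lebesgue. indicator {0<..<1} t *\<^sub>R k t = indicator {0..1} t *\<^sub>R h t"
    by (simp add: AE_completion_iff)
  have m1: "(\<lambda>t. indicator {0<..<1} t *\<^sub>R k t) \<in> borel_measurable lebesgue"
    by (rule measurable_completion) measurable
  have m2: "(\<lambda>t. indicator {0..1} t *\<^sub>R h t) \<in> borel_measurable lebesgue"
    by (rule borel_measurable_AE[OF m1 ae'])
  have "(LINT t:{0..1}|lebesgue. h t) = (LINT t|lebesgue. indicator {0<..<1} t *\<^sub>R k t)"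
    unfolding set_lebesgue_integral_def using ae' by (intro integral_cong_AE m1 m2) auto
  also have "\<dots> = (LINT t|lborel. indicator {0<..<1} t *\<^sub>R k t)"
    by (rule integral_completion) measurable
  also have "\<dots> = (LINT t|unif. k t)"
    unfolding unif_def by (subst integral_density) auto
  finally show ?thesis .
qed

text \<open>
The two-increasing property, applied to the strips below and above \<open>x\<close>, makes the section monotone
and 1-Lipschitz on the unit interval.  It is extended by constants to the real line.
\<close>

lemma copula_section:
  assumes C: "copula C" and x: "x \<in> {0..1}"
  obtains g where "g \<in> borel_measurable borel" "\<And>t. 0 \<le> g t \<and> g t \<le> 1"
    "AE t in unif. (C x has_real_derivative g t) (at t)"
    "AE t in unif. deriv (\<lambda>s. C x s) t = g t"
    "\<And>s. s \<in> {0..1} \<Longrightarrow> measure (density unif (\<lambda>t. ennreal (g t))) {..s} = C x s"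
proof -
  define cl where "cl s = max 0 (min 1 s)" for s :: real
  define f where "f s = C x (cl s)" for s
  have cl: "cl s \<in> {0..1}" for s by (auto simp: cl_def)
  have two_incr: "C u b - C u a - C w b + C w a \<ge> 0"
    if "w \<in> {0..1}" "u \<in> {0..1}" "a \<in> {0..1}" "b \<in> {0..1}" "w \<le> u" "a \<le> b" for u w a b
    using C that unfolding copula_def by blast
  have bd: "C u 0 = 0" "C 0 u = 0" "C u 1 = u" "C 1 u = u" if "u \<in> {0..1}" for u
    using C that unfolding copula_def by blast+
  have mono: "mono f"
    unfolding mono_def f_def
  proof (intro allI impI)
    fix a b :: real assume "a \<le> b"
    then have "cl a \<le> cl b" by (auto simp: cl_def)
    then show "C x (cl a) \<le> C x (cl b)" using two_incr[of 0 x "cl a" "cl b"] bd(2)[OF cl] x cl by auto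
  qed
  have lip: "f b - f a \<le> b - a" if "a \<le> b" for a b
  proof -
    have "cl a \<le> cl b" "cl b - cl a \<le> b - a" using that by (auto simp: cl_def)
    then show ?thesis using two_incr[of x 1 "cl a" "cl b"] bd(4)[OF cl] x cl
      unfolding f_def by auto
  qed
  obtain g where g: "g \<in> borel_measurable borel" "\<And>t. 0 \<le> g t \<and> g t \<le> 1"
    "\<And>a b. a \<le> b \<Longrightarrow> emeasure (density lborel (\<lambda>t. ennreal (g t))) {a..b} = ennreal (f b - f a)"
    "AE t in lborel. (f has_real_derivative g t) (at t)"
    using lipschitz_mono_density[OF mono lip] by blast
  have g1[measurable]: "g \<in> borel_measurable borel" by fact
  have D: "AE t in unif. (C x has_real_derivative g t) (at t)"
    unfolding AE_unif using g(4)
  proof eventually_elim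
    case (elim t)
    show ?case
    proof
      assume t: "0 < t \<and> t < 1"
      show "(C x has_real_derivative g t) (at t)"
        by (rule has_field_derivative_transform_within_open[OF elim, of "{0<..<1}"])
          (use t in \<open>auto simp: f_def cl_def\<close>)
    qed
  qed
  show thesis
  proof (rule that[OF g(1,2) D])
    show "AE t in unif. deriv (\<lambda>s. C x s) t = g t"
      using D by eventually_elim (simp add: DERIV_imp_deriv)
    fix s :: real assume s: "s \<in> {0..1}"
    have "emeasure (density unif (\<lambda>t. ennreal (g t))) {..s}
      = (\<integral>\<^sup>+t. ennreal (indicator {0<..<1} t) * (ennreal (g t) * indicator {..s} t) \<partial>lborel)"
      unfolding unif_def by (subst density_density_eq) (auto simp: emeasure_density mult.assoc)
    also have "\<dots> = (\<integral>\<^sup>+t. ennreal (g t) * indicator {0..s} t \<partial>lborel)"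
    proof (rule nn_integral_cong_AE)
      have "AE t in lborel. t \<noteq> 0" "AE t in lborel. t \<noteq> (1::real)" by (rule AE_lborel_singleton)+
      then show "AE t in lborel. ennreal (indicator {0<..<1} t) * (ennreal (g t) * indicator {..s} t)
         = ennreal (g t) * indicator {0..s} t"
        by eventually_elim (use s in \<open>auto simp: indicator_def\<close>)
    qed
    also have "\<dots> = ennreal (f s - f 0)"
      using g(3)[of 0 s] s by (simp add: emeasure_density)
    also have "f s - f 0 = C x s" using s bd(1)[OF x] by (simp add: f_def cl_def)
    finally show "measure (density unif (\<lambda>t. ennreal (g t))) {..s} = C x s"
      using C x s by (simp add: measure_def copula_def)
  qed
qed

section \<open>Copulas as joint distribution functions of uniform variables\<close>

lemma real_distribution_eq_unifI:
  assumes N: "real_distribution N" and u: "\<And>u. u \<in> {0..1} \<Longrightarrow> cdf N u = u"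
  shows "N = unif"
proof (rule cdf_unique[OF N real_distribution_unif], rule ext)
  fix x :: real
  interpret real_distribution N by fact
  consider "x < 0" | "x \<in> {0..1}" | "x > 1" by (meson atLeastAtMost_iff not_le)
  then show "cdf N x = cdf unif x"
  proof cases
    case 1
    then show ?thesis using cdf_nondecreasing[of x 0] cdf_nonneg[of x] u[of 0] by (simp add: cdf_unif)
  next
    case 3
    then show ?thesis using cdf_nondecreasing[of 1 x] cdf_bounded_prob[of x] u[of 1] by (simp add: cdf_unif)
  qed (auto simp: u cdf_unif)
qed

text \<open>
The quadrants form an intersection-stable generator of the Borel sets of the plane.
\<close>

lemma joint_law_eqI:
  fixes N N' :: "(real \<times> real) measure"
  assumes N: "prob_space N" "sets N = sets borel" and N': "prob_space N'" "sets N' = sets borel"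
    and eq: "\<And>x y. measure N ({..x} \<times> {..y}) = measure N' ({..x} \<times> {..y})"
  shows "N = N'"
proof -
  interpret N: prob_space N by fact
  interpret N': prob_space N' by fact
  let ?E = "range (\<lambda>(x::real, y::real). {..x} \<times> {..y})"
  have Iic: "{..a} = {..fst a} \<times> {..snd a}" for a :: "real \<times> real"
    by (auto simp: less_eq_prod_def)
  have E: "?E = range (\<lambda>a::real \<times> real. {..a})"
    by (auto simp: Iic image_def)
  have sets: "sets borel = sigma_sets UNIV ?E"
    unfolding E by (subst borel_eq_atMost) (simp add: sets_measure_of)
  show ?thesis
  proof (rule measure_eqI_generator_eq[where \<Omega>=UNIV and E="?E" and A="\<lambda>n. {..real n} \<times> {..real n}"])
    show "Int_stable ?E"
      unfolding Int_stable_def by (auto simp: Times_Int_Times)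
    show "(\<Union>n. {..real n} \<times> {..real n}) = UNIV"
    proof safe
      fix a b :: real
      obtain n where "max a b \<le> real n" using real_arch_simple by blast
      then show "(a, b) \<in> (\<Union>n. {..real n} \<times> {..real n})" by auto
    qed simp_all
  qed (auto simp: N N' sets N.emeasure_eq_measure N'.emeasure_eq_measure eq)
qed

definition uniform_rv :: "'a measure \<Rightarrow> ('a \<Rightarrow> real) \<Rightarrow> bool" where
  "uniform_rv M P \<longleftrightarrow> P \<in> borel_measurable M \<and> distr M borel P = unif"

text \<open>
For uniform variables the copula is the joint distribution function itself, on the unit square.
\<close>

definition uniform_pair :: "'a measure \<Rightarrow> ('a \<Rightarrow> real) \<Rightarrow> ('a \<Rightarrow> real) \<Rightarrow> (real \<Rightarrow> real \<Rightarrow> real) \<Rightarrow> bool" where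
  "uniform_pair M P Q C \<longleftrightarrow> uniform_rv M P \<and> uniform_rv M Q \<and>
     (\<forall>u\<in>{0..1}. \<forall>v\<in>{0..1}. measure M {\<omega> \<in> space M. P \<omega> \<le> u \<and> Q \<omega> \<le> v} = C u v)"

lemma uniform_rv_AE:
  assumes "uniform_rv M P" shows "AE \<omega> in M. 0 < P \<omega> \<and> P \<omega> < 1"
proof -
  have [measurable]: "P \<in> borel_measurable M" and d: "distr M borel P = unif"
    using assms by (auto simp: uniform_rv_def)
  have "AE t in distr M borel P. 0 < t \<and> t < 1" unfolding d AE_unif by simp
  then show ?thesis by (subst (asm) AE_distr_iff) auto
qed

lemma uniform_rv_comp:
  assumes "uniform_rv M P" "\<phi> \<in> borel_measurable borel" "distr unif borel \<phi> = unif"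
  shows "uniform_rv M (\<lambda>\<omega>. \<phi> (P \<omega>))"
proof -
  have [measurable]: "P \<in> borel_measurable M" and d: "distr M borel P = unif"
    using assms by (auto simp: uniform_rv_def)
  have "distr M borel (\<lambda>\<omega>. \<phi> (P \<omega>)) = distr (distr M borel P) borel \<phi>"
    using assms(2) by (simp add: distr_distr o_def)
  then show ?thesis unfolding d assms(3) using assms(2) by (simp add: uniform_rv_def)
qed

lemma uniform_rv_cdf: "uniform_rv M P \<Longrightarrow> cdf (distr M borel P) x = max 0 (min 1 x)"
  by (simp add: uniform_rv_def cdf_unif)

lemma uniform_rv_prob_le:
  assumes "uniform_rv M P" shows "measure M {\<omega>\<in>space M. P \<omega> \<le> x} = max 0 (min 1 x)"
proof -
  have [measurable]: "P \<in> borel_measurable M" using assms by (auto simp: uniform_rv_def)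
  have "cdf (distr M borel P) x = measure M {\<omega>\<in>space M. P \<omega> \<le> x}"
    unfolding cdf_def by (subst measure_distr) (auto intro!: arg_cong[where f="measure M"])
  then show ?thesis using uniform_rv_cdf[OF assms] by simp
qed

lemma uniform_rv_continuous: "uniform_rv M P \<Longrightarrow> continuous_rv M P"
  unfolding continuous_rv_def
  by (auto simp: uniform_rv_def cdf_unif[abs_def] intro!: continuous_intros)

lemma uniform_pair_joint_cdf:
  assumes M: "prob_space M" and PQ: "uniform_pair M P Q C"
  shows "measure M {\<omega> \<in> space M. P \<omega> \<le> x \<and> Q \<omega> \<le> y} = C (max 0 (min 1 x)) (max 0 (min 1 y))"
proof -
  interpret prob_space M by fact
  have P: "uniform_rv M P" and Q: "uniform_rv M Q" using PQ by (auto simp: uniform_pair_def)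
  then have [measurable]: "P \<in> borel_measurable M" "Q \<in> borel_measurable M" by (auto simp: uniform_rv_def)
  have "measure M {\<omega> \<in> space M. P \<omega> \<le> x \<and> Q \<omega> \<le> y}
     = measure M {\<omega> \<in> space M. P \<omega> \<le> max 0 (min 1 x) \<and> Q \<omega> \<le> max 0 (min 1 y)}"
  proof (rule finite_measure_eq_AE)
    show "AE \<omega> in M. (\<omega> \<in> {\<omega> \<in> space M. P \<omega> \<le> x \<and> Q \<omega> \<le> y}) = 
       (\<omega> \<in> {\<omega> \<in> space M. P \<omega> \<le> max 0 (min 1 x) \<and> Q \<omega> \<le> max 0 (min 1 y)})"
      using uniform_rv_AE[OF P] uniform_rv_AE[OF Q] by eventually_elim auto
  qed auto
  then show ?thesis using PQ by (simp add: uniform_pair_def)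
qed

lemma uniform_pair_copula:
  assumes M: "prob_space M" and PQ: "uniform_pair M P Q C"
  shows "copula C"
proof -
  interpret prob_space M by fact
  have P: "uniform_rv M P" and Q: "uniform_rv M Q" using PQ by (auto simp: uniform_pair_def)
  then have [measurable]: "P \<in> borel_measurable M" "Q \<in> borel_measurable M" by (auto simp: uniform_rv_def)
  have C: "C u v = measure M {\<omega> \<in> space M. P \<omega> \<le> u \<and> Q \<omega> \<le> v}" if "u \<in> {0..1}" "v \<in> {0..1}" for u v
    using PQ that by (simp add: uniform_pair_def)
  show ?thesis
    unfolding copula_def
  proof (intro conjI ballI impI)
    fix u v :: real assume "u \<in> {0..1}" "v \<in> {0..1}"
    then show "C u v \<in> {0..1}" by (simp add: C)
  next
    fix u :: real assume u: "u \<in> {0..1}"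
    have [simp]: "max 0 (min 1 u) = u" using u by auto
    have "C u 0 \<le> measure M {\<omega>\<in>space M. Q \<omega> \<le> 0}"
      using u by (subst C) (auto intro!: finite_measure_mono)
    then show "C u 0 = 0" using u by (simp add: uniform_rv_prob_le[OF Q] C measure_le_0_iff)
    have "C 0 u \<le> measure M {\<omega>\<in>space M. P \<omega> \<le> 0}"
      using u by (subst C) (auto intro!: finite_measure_mono)
    then show "C 0 u = 0" using u by (simp add: uniform_rv_prob_le[OF P] C measure_le_0_iff)
    have "C u 1 = measure M {\<omega>\<in>space M. P \<omega> \<le> u}"
      using u uniform_rv_AE[OF Q] by (subst C) (auto intro!: finite_measure_eq_AE)
    then show "C u 1 = u" by (simp add: uniform_rv_prob_le[OF P])
    have "C 1 u = measure M {\<omega>\<in>space M. Q \<omega> \<le> u}"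
      using u uniform_rv_AE[OF P] by (subst C) (auto intro!: finite_measure_eq_AE)
    then show "C 1 u = u" by (simp add: uniform_rv_prob_le[OF Q])
  next
    fix x u y v :: real
    assume *: "x \<in> {0..1}" "u \<in> {0..1}" "y \<in> {0..1}" "v \<in> {0..1}" "x \<le> u" "y \<le> v"
    let ?A = "\<lambda>u v. {\<omega> \<in> space M. P \<omega> \<le> u \<and> Q \<omega> \<le> v}"
    have 1: "measure M (?A u v - ?A x v) = C u v - C x v"
      using * by (subst finite_measure_Diff) (auto simp: C)
    have 2: "measure M (?A u y - ?A x y) = C u y - C x y"
      using * by (subst finite_measure_Diff) (auto simp: C)
    have "measure M (?A u y - ?A x y) \<le> measure M (?A u v - ?A x v)"
      using * by (intro finite_measure_mono) auto
    then show "C u v - C u y - C x v + C x y \<ge> 0" unfolding 1 2 by simp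
  qed
qed

lemma uniform_pair_is_copula_of:
  assumes M: "prob_space M" and PQ: "uniform_pair M P Q C"
  shows "is_copula_of M P Q C"
  unfolding is_copula_of_def
  using uniform_pair_copula[OF assms] uniform_pair_joint_cdf[OF assms] PQ
  by (simp add: uniform_pair_def uniform_rv_cdf)

lemma uniform_pair_transpose:
  "uniform_pair M P Q C \<Longrightarrow> uniform_pair M Q P (\<lambda>x y. C y x)"
  unfolding uniform_pair_def by (simp add: conj_commute)

lemma measurable_Pair_borel:
  "P \<in> borel_measurable M \<Longrightarrow> Q \<in> borel_measurable M \<Longrightarrow> (\<lambda>\<omega>. (P \<omega> :: real, Q \<omega> :: real)) \<in> M \<rightarrow>\<^sub>M borel"
  unfolding borel_prod[symmetric] by measurable

lemma measure_joint_law: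
  assumes "P \<in> borel_measurable M" "Q \<in> borel_measurable M"
  shows "measure (distr M borel (\<lambda>\<omega>. (P \<omega> :: real, Q \<omega> :: real))) ({..x} \<times> {..y})
     = measure M {\<omega> \<in> space M. P \<omega> \<le> x \<and> Q \<omega> \<le> y}"
proof -
  have "{..x} \<times> {..y} \<in> sets borel" by (intro borel_closed closed_Times) auto
  then show ?thesis
    by (subst measure_distr[OF measurable_Pair_borel[OF assms]]) (auto intro!: arg_cong[where f="measure M"])
qed

text \<open>
The copula fixes the joint law: outside the unit square the joint distribution function is obtained
by clamping the arguments.
\<close>

lemma uniform_pair_joint_law:
  assumes M: "prob_space M" "uniform_pair M P Q C" and N: "prob_space N" "uniform_pair N P' Q' C'"
    and C: "copula_eq C C'"
  shows "distr M borel (\<lambda>\<omega>. (P \<omega>, Q \<omega>)) = distr N borel (\<lambda>\<omega>. (P' \<omega>, Q' \<omega>))"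
proof -
  interpret M: prob_space M by fact
  interpret N: prob_space N by fact
  have m: "P \<in> borel_measurable M" "Q \<in> borel_measurable M" "P' \<in> borel_measurable N" "Q' \<in> borel_measurable N"
    using M N by (auto simp: uniform_pair_def uniform_rv_def)
  show ?thesis
  proof (rule joint_law_eqI)
    show "prob_space (distr M borel (\<lambda>\<omega>. (P \<omega>, Q \<omega>)))" "prob_space (distr N borel (\<lambda>\<omega>. (P' \<omega>, Q' \<omega>)))"
      using m by (auto intro!: M.prob_space_distr N.prob_space_distr measurable_Pair_borel)
  qed (use C in \<open>auto simp: measure_joint_law m uniform_pair_joint_cdf[OF M] uniform_pair_joint_cdf[OF N] copula_eq_def\<close>)
qed

text \<open>
The derivative of \<open>C\<close> in its first argument is the conditional probability of \<open>Q \<le> y\<close> given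
\<open>P = t\<close>.  Both sides, as functions of \<open>B\<close>, are finite measures on the line, and their distribution
functions agree because the section is the integral of its derivative.
\<close>

lemma integral_section_derivative:
  assumes M: "prob_space M" and PQ: "uniform_pair M P Q C" and y: "y \<in> {0..1}"
    and B: "B \<in> sets borel" and h: "AE t in unif. h t = indicator B t"
  shows "(LINT t:{0..1}|lebesgue. h t * deriv (\<lambda>s. C s y) t) = measure M {\<omega> \<in> space M. P \<omega> \<in> B \<and> Q \<omega> \<le> y}"
proof -
  interpret M: prob_space M by fact
  interpret unif: prob_space unif by (rule prob_space_unif)
  have P: "uniform_rv M P" and Q: "uniform_rv M Q" using PQ by (auto simp: uniform_pair_def)
  then have [measurable]: "P \<in> borel_measurable M" "Q \<in> borel_measurable M" by (auto simp: uniform_rv_def)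
  note [measurable] = B
  obtain g where g: "g \<in> borel_measurable borel" "\<And>t. 0 \<le> g t \<and> g t \<le> 1"
    "AE t in unif. deriv (\<lambda>s. C s y) t = g t"
    "\<And>s. s \<in> {0..1} \<Longrightarrow> measure (density unif (\<lambda>t. ennreal (g t))) {..s} = C s y"
    using copula_section[OF copula_transpose[OF uniform_pair_copula[OF M PQ]] y] by metis
  note [measurable] = g(1)
  define N1 where "N1 = density unif (\<lambda>t. ennreal (g t))"
  define N2 where "N2 = distr (density M (\<lambda>\<omega>. ennreal (indicator {\<omega> \<in> space M. Q \<omega> \<le> y} \<omega>))) borel P"
  have sN: "sets N1 = sets borel" "sets N2 = sets borel" "space N1 = UNIV" "space N2 = UNIV"
    by (simp_all add: N1_def N2_def)
  have em2: "emeasure N2 A = emeasure M {\<omega> \<in> space M. P \<omega> \<in> A \<and> Q \<omega> \<le> y}" if [measurable]: "A \<in> sets borel" for A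
  proof -
    have "emeasure N2 A = (\<integral>\<^sup>+\<omega>. indicator {\<omega> \<in> space M. Q \<omega> \<le> y} \<omega> * indicator (P -` A \<inter> space M) \<omega> \<partial>M)"
      unfolding N2_def by (subst emeasure_distr) (auto simp: emeasure_density ennreal_indicator)
    also have "\<dots> = (\<integral>\<^sup>+\<omega>. indicator {\<omega> \<in> space M. P \<omega> \<in> A \<and> Q \<omega> \<le> y} \<omega> \<partial>M)"
      by (intro nn_integral_cong) (auto simp: indicator_def)
    finally show ?thesis by simp
  qed
  have em1: "emeasure N1 A = ennreal (LINT t|unif. indicator A t * g t)" if [measurable]: "A \<in> sets borel" for A
  proof -
    have int: "integrable unif (\<lambda>t. indicator A t * g t)"
      by (rule unif.integrable_const_bound[of _ 1]) (use g(2) in \<open>auto simp: indicator_def\<close>)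
    have "emeasure N1 A = (\<integral>\<^sup>+t. ennreal (indicator A t * g t) \<partial>unif)"
      unfolding N1_def by (subst emeasure_density) (auto intro!: nn_integral_cong simp: indicator_def)
    also have "\<dots> = ennreal (LINT t|unif. indicator A t * g t)"
      by (rule nn_integral_eq_integral[OF int]) (use g(2) in auto)
    finally show ?thesis .
  qed
  have "N1 = N2"
  proof (rule cdf_unique')
    show 1: "finite_borel_measure N1"
      by (intro finite_borel_measure.intro finite_borel_measure_axioms.intro finite_measureI) (simp_all add: sN em1)
    show 2: "finite_borel_measure N2"
      by (intro finite_borel_measure.intro finite_borel_measure_axioms.intro finite_measureI) (simp_all add: sN em2)
    show "cdf N1 = cdf N2"
    proof
      fix s :: real
      define cs where "cs = max 0 (min 1 s)"
      have cs: "cs \<in> {0..1}" by (auto simp: cs_def)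
      have "AE t in unif. 0 < t \<and> t < 1" by (simp add: AE_unif)
      then have "AE t in unif. indicator {..s} t * g t = indicator {..cs} t * g t"
        by eventually_elim (auto simp: cs_def indicator_def)
      then have "(LINT t|unif. indicator {..s} t * g t) = (LINT t|unif. indicator {..cs} t * g t)"
        by (intro integral_cong_AE) auto
      then have "cdf N1 s = measure N1 {..cs}"
        unfolding cdf_def measure_def by (simp add: em1)
      also have "\<dots> = C cs y" unfolding N1_def by (rule g(4)[OF cs])
      also have "\<dots> = measure M {\<omega> \<in> space M. P \<omega> \<le> s \<and> Q \<omega> \<le> y}"
        unfolding uniform_pair_joint_cdf[OF M PQ] cs_def using y by simp
      also have "\<dots> = cdf N2 s" unfolding cdf_def measure_def by (simp add: em2)
      finally show "cdf N1 s = cdf N2 s" .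
    qed
  qed
  then have eq: "ennreal (LINT t|unif. indicator B t * g t) = emeasure M {\<omega> \<in> space M. P \<omega> \<in> B \<and> Q \<omega> \<le> y}"
    using em1[OF B] em2[OF B] by simp
  have "(LINT t:{0..1}|lebesgue. h t * deriv (\<lambda>s. C s y) t) = (LINT t|unif. indicator B t * g t)"
  proof (rule lebesgue_unit_integral_eq_unif)
    show "AE t in unif. h t * deriv (\<lambda>s. C s y) t = indicator B t * g t"
      using h g(3) by eventually_elim simp
  qed measurable
  also have "\<dots> = measure M {\<omega> \<in> space M. P \<omega> \<in> B \<and> Q \<omega> \<le> y}"
    using eq unfolding M.emeasure_eq_measure
    by (subst (asm) ennreal_inj) (auto intro!: integral_nonneg_AE simp: g(2))
  finally show ?thesis .
qed

section \<open>Invertible copulas and measure-preserving maps\<close>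

text \<open>
Transposition reverses products, so that every statement about left factors also yields one about
right factors.
\<close>

lemma copula_prod_transpose:
  "copula_prod C D x y = copula_prod (\<lambda>x y. D y x) (\<lambda>x y. C y x) y x"
  unfolding copula_prod_def by (simp add: mult.commute)

lemma copula_prod_eq_min_transpose:
  assumes "copula_eq (copula_prod C D) min_copula"
  shows "copula_eq (copula_prod (\<lambda>x y. D y x) (\<lambda>x y. C y x)) min_copula"
  unfolding copula_eq_def
proof (intro ballI)
  fix x y :: real assume "x \<in> {0..1}" "y \<in> {0..1}"
  then show "copula_prod (\<lambda>x y. D y x) (\<lambda>x y. C y x) x y = min_copula x y"
    using assms unfolding copula_prod_transpose[of C D y x, symmetric]
    by (simp add: copula_eq_def min_copula_def min.commute)
qed

lemma copulaD:
  assumes "copula C" "u \<in> {0..1}"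
  shows "C u 0 = 0" "C 0 u = 0" "C u 1 = u" "C 1 u = u"
  using assms unfolding copula_def by blast+

lemma section_integral:
  assumes g: "g \<in> borel_measurable borel" "\<And>t. 0 \<le> g t \<and> g t \<le> 1"
    and e: "measure (density unif (\<lambda>t. ennreal (g t))) {..s} = c"
  shows "(LINT t|unif. indicator {..s} t * g t) = c"
proof -
  interpret prob_space unif by (rule prob_space_unif)
  note [measurable] = g(1)
  have int: "integrable unif (\<lambda>t. indicator {..s} t * g t)"
    by (rule integrable_const_bound[of _ 1]) (use g(2) in \<open>auto simp: indicator_def\<close>)
  have "emeasure (density unif (\<lambda>t. ennreal (g t))) {..s} = (\<integral>\<^sup>+t. ennreal (indicator {..s} t * g t) \<partial>unif)"
    by (subst emeasure_density) (auto intro!: nn_integral_cong simp: indicator_def)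
  also have "\<dots> = ennreal (LINT t|unif. indicator {..s} t * g t)"
    by (rule nn_integral_eq_integral[OF int]) (use g(2) in auto)
  finally have "measure (density unif (\<lambda>t. ennreal (g t))) {..s} = (LINT t|unif. indicator {..s} t * g t)"
    unfolding measure_def using g(2) by (simp add: integral_nonneg_AE)
  then show "(LINT t|unif. indicator {..s} t * g t) = c" using e by simp
qed

lemma section_integral_total:
  assumes g: "g \<in> borel_measurable borel" "\<And>t. 0 \<le> g t \<and> g t \<le> 1"
    and e: "measure (density unif (\<lambda>t. ennreal (g t))) {..1} = c"
  shows "integrable unif g" "(LINT t|unif. g t) = c"
proof -
  interpret prob_space unif by (rule prob_space_unif)
  note [measurable] = g(1)
  show int: "integrable unif g"
    by (rule integrable_const_bound[of _ 1]) (use g(2) in auto)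
  have ae: "AE t in unif. indicator {..1} t * g t = g t" unfolding AE_unif by simp
  then have "(LINT t|unif. indicator {..1} t * g t) = (LINT t|unif. g t)"
    by (intro integral_cong_AE) auto
  then show "(LINT t|unif. g t) = c" using section_integral[OF g e] by simp
qed

text \<open>
Let \<open>g\<close> and \<open>k\<close> be the derivatives of \<open>U(x, \<cdot>)\<close> and \<open>D(\<cdot>, x)\<close>.  Both have integral \<open>x\<close>, and so has
\<open>g k\<close> because the product of the copulas is the minimum.  As \<open>g k \<le> g\<close> and \<open>g k \<le> k\<close>, equality
holds almost everywhere, whence \<open>g = k\<close> and \<open>g = g\<^sup>2\<close>.
\<close>

lemma inverse_section_zero_one:
  assumes U: "copula U" and D: "copula D" and UD: "copula_eq (copula_prod U D) min_copula"
    and x: "x \<in> {0..1}"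
  shows "AE t in unif. deriv (\<lambda>s. U x s) t = 0 \<or> deriv (\<lambda>s. U x s) t = 1"
proof -
  interpret prob_space unif by (rule prob_space_unif)
  obtain g where g: "g \<in> borel_measurable borel" "\<And>t. 0 \<le> g t \<and> g t \<le> 1"
    "AE t in unif. deriv (\<lambda>s. U x s) t = g t"
    "\<And>s. s \<in> {0..1} \<Longrightarrow> measure (density unif (\<lambda>t. ennreal (g t))) {..s} = U x s"
    using copula_section[OF U x] by metis
  obtain k where k: "k \<in> borel_measurable borel" "\<And>t. 0 \<le> k t \<and> k t \<le> 1"
    "AE t in unif. deriv (\<lambda>s. D s x) t = k t"
    "\<And>s. s \<in> {0..1} \<Longrightarrow> measure (density unif (\<lambda>t. ennreal (k t))) {..s} = D s x"
    using copula_section[OF copula_transpose[OF D] x] by metis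
  note [measurable] = g(1) k(1)
  have gi: "integrable unif g" "(LINT t|unif. g t) = x"
    using section_integral_total[OF g(1,2) g(4)[of 1]] copulaD[OF U x] by auto
  have ki: "integrable unif k" "(LINT t|unif. k t) = x"
    using section_integral_total[OF k(1,2) k(4)[of 1]] copulaD[OF D x] by auto
  have gk: "integrable unif (\<lambda>t. g t * k t)"
    by (rule integrable_const_bound[of _ 1]) (use g(2) k(2) in \<open>auto simp: abs_mult intro!: mult_le_one\<close>)
  have "copula_prod U D x x = (LINT t|unif. g t * k t)"
    unfolding copula_prod_def
  proof (rule lebesgue_unit_integral_eq_unif)
    show "AE t in unif. deriv (\<lambda>s. U x s) t * deriv (\<lambda>s. D s x) t = g t * k t"
      using g(3) k(3) by eventually_elim simp
  qed measurable
  then have gkx: "(LINT t|unif. g t * k t) = x"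
    using UD x by (simp add: copula_eq_def min_copula_def)
  have "AE t in unif. g t - g t * k t = 0"
    using gi ki gk gkx g(2) k(2)
    by (subst integral_nonneg_eq_0_iff_AE[symmetric]) (auto simp: mult_left_le)
  moreover have "AE t in unif. k t - g t * k t = 0"
    using gi ki gk gkx g(2) k(2)
    by (subst integral_nonneg_eq_0_iff_AE[symmetric]) (auto simp: mult_left_le_one_le)
  ultimately show ?thesis using g(3)
  proof eventually_elim
    case (elim t)
    then have "g t = k t" by linarith
    with elim have "g t * (1 - g t) = 0" by (simp add: algebra_simps)
    then show ?case using elim by auto
  qed
qed

lemma section_derivative_mono:
  assumes U: "copula U" and xy: "x \<in> {0..1}" "y \<in> {0..1}" "x \<le> y"
  shows "AE t in unif. deriv (\<lambda>s. U x s) t \<le> deriv (\<lambda>s. U y s) t"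
proof -
  obtain g where g: "AE t in unif. (U x has_real_derivative g t) (at t)"
    using copula_section[OF U xy(1)] by metis
  obtain k where k: "AE t in unif. (U y has_real_derivative k t) (at t)"
    using copula_section[OF U xy(2)] by metis
  have m: "mono_on {0..1} (\<lambda>s. U y s - U x s)"
  proof (rule mono_onI)
    fix a b :: real assume "a \<in> {0..1}" "b \<in> {0..1}" "a \<le> b"
    then have "U y b - U y a - U x b + U x a \<ge> 0" using U xy unfolding copula_def by blast
    then show "U y a - U x a \<le> U y b - U x b" by simp
  qed
  have "AE t in unif. 0 < t \<and> t < 1" by (simp add: AE_unif)
  with g k show ?thesis
  proof eventually_elim
    case (elim t)
    have "((\<lambda>s. U y s - U x s) has_real_derivative k t - g t) (at t)"
      using elim by (intro DERIV_diff) auto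
    then have "0 \<le> k t - g t"
      by (rule mono_on_imp_deriv_nonneg[OF m]) (use elim in simp)
    then show ?case using elim by (simp add: DERIV_imp_deriv)
  qed
qed

text \<open>
The derivatives \<open>g\<^sub>x\<close> of the sections are almost everywhere indicators, increasing in \<open>x\<close>, so that
\<open>\<phi> t\<close> can be defined as the threshold \<open>x\<close> at which \<open>g\<^sub>x t\<close> jumps from \<open>0\<close> to \<open>1\<close>.  Only rational
thresholds are used, to keep to countably many null sets.  Since \<open>g\<^sub>x\<close> has integral \<open>x\<close>, the map
\<open>\<phi>\<close> preserves the uniform law.
\<close>

lemma exists_measure_preserving_of_zero_one_sections:
  assumes U: "copula U"
    and U01: "\<And>x. x \<in> {0..1} \<Longrightarrow> AE t in unif. deriv (\<lambda>s. U x s) t = 0 \<or> deriv (\<lambda>s. U x s) t = 1"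
  obtains \<phi> where "\<phi> \<in> borel_measurable borel" "distr unif borel \<phi> = unif"
    "\<And>x. x \<in> {0..1} \<Longrightarrow> AE t in unif. deriv (\<lambda>s. U x s) t = indicator {t. \<phi> t \<le> x} t"
proof -
  interpret prob_space unif by (rule prob_space_unif)
  \<comment> \<open>A Borel version of the derivative has to be chosen for every \<open>x\<close>.\<close>
  define is_section where "is_section x g \<longleftrightarrow> g \<in> borel_measurable borel \<and> (\<forall>t. 0 \<le> g t \<and> g t \<le> 1) \<and>
    (AE t in unif. deriv (\<lambda>s. U x s) t = g t) \<and>
    (\<forall>s\<in>{0..1}. measure (density unif (\<lambda>t. ennreal (g t))) {..s} = U x s)" for x g
  have "\<exists>g. is_section x g" if x: "x \<in> {0..1}" for x
    by (rule copula_section[OF U x]) (auto simp: is_section_def)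
  then obtain g where g: "\<And>x. x \<in> {0..1} \<Longrightarrow> is_section x (g x)" by metis
  have g_m: "g x \<in> borel_measurable borel" and g_le: "\<And>t. 0 \<le> g x t \<and> g x t \<le> 1"
    and g_d: "AE t in unif. deriv (\<lambda>s. U x s) t = g x t"
    and g_i: "\<And>s. s \<in> {0..1} \<Longrightarrow> measure (density unif (\<lambda>t. ennreal (g x t))) {..s} = U x s"
    if "x \<in> {0..1}" for x
    using g[OF that] unfolding is_section_def by blast+
  have g_int: "integrable unif (g x)" "(LINT t|unif. g x t) = x" if x: "x \<in> {0..1}" for x
    using section_integral_total[OF g_m[OF x] g_le[OF x] g_i[OF x, of 1]] copulaD[OF U x] by auto
  have g01: "AE t in unif. g x t = 0 \<or> g x t = 1" if "x \<in> {0..1}" for x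
    using U01[OF that] g_d[OF that] by eventually_elim simp
  have g_mono: "AE t in unif. g x t \<le> g y t" if "x \<in> {0..1}" "y \<in> {0..1}" "x \<le> y" for x y
    using section_derivative_mono[OF U that] g_d[OF that(1)] g_d[OF that(2)] by eventually_elim simp
  define R where "R = \<rat> \<inter> {0..1::real}"
  have R: "countable R" "R \<noteq> {}" "R \<subseteq> {0..1}" "1 \<in> R"
    by (auto simp: R_def countable_rat)
  define \<phi> where "\<phi> t = (INF r\<in>R. if g r t = 1 then r else 1)" for t
  have bb: "bdd_below ((\<lambda>r. if g r t = 1 then r else 1) ` R)" for t
    using R(3) by (auto intro!: bdd_belowI[of _ 0])
  have \<phi>_m [measurable]: "\<phi> \<in> borel_measurable borel"
    unfolding \<phi>_def
  proof (rule borel_measurable_cINF[OF R(1) _ bb])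
    fix r assume "r \<in> R"
    then have [measurable]: "g r \<in> borel_measurable borel" using R by (intro g_m) auto
    show "(\<lambda>t. if g r t = 1 then r else 1) \<in> borel_measurable borel" by measurable
  qed
  \<comment> \<open>The derivative lies between the indicators of \<open>\<phi> t < x\<close> and \<open>\<phi> t \<le> x\<close>; these agree almost everywhere once \<open>\<phi>\<close> is known to have no atoms.\<close>
  have sandwich: "AE t in unif. indicator {t. \<phi> t < x} t \<le> g x t \<and> (x < 1 \<longrightarrow> g x t \<le> indicator {t. \<phi> t \<le> x} t)"
    if x: "x \<in> {0..1}" for x
  proof -
    have "AE t in unif. \<forall>r\<in>R. r \<le> x \<longrightarrow> g r t \<le> g x t"
      using R x by (subst AE_ball_countable) (auto intro!: g_mono)
    moreover have "AE t in unif. \<forall>r\<in>R. x \<le> r \<longrightarrow> g x t \<le> g r t"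
      using R x by (subst AE_ball_countable) (auto intro!: g_mono)
    moreover have "AE t in unif. \<forall>r\<in>R. g r t = 0 \<or> g r t = 1"
      using R x by (subst AE_ball_countable) (auto intro!: g01)
    moreover note g01[OF x]
    ultimately show ?thesis
    proof eventually_elim
      case (elim t)
      have 1: "g x t = 1" if lt: "\<phi> t < x"
      proof -
        obtain r where r: "r \<in> R" "(if g r t = 1 then r else 1) < x"
          using lt unfolding \<phi>_def using cINF_less_iff[OF R(2) bb] by blast
        then have "g r t = 1" "r \<le> x" using x by (auto split: if_splits)
        then show ?thesis using elim r g_le[OF x, of t] by force
      qed
      have 2: "\<phi> t \<le> x" if g1: "g x t = 1" and x1: "x < 1"
      proof (rule field_le_epsilon)
        fix e :: real assume "e > 0"
        then obtain r where r: "r \<in> \<rat>" "x < r" "r < min 1 (x + e)" using Rats_dense_in_real[of x "min 1 (x + e)"] x1 by auto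
        then have rR: "r \<in> R" using x by (auto simp: R_def)
        have "g r t = 1" using elim rR r g1 by force
        then have "\<phi> t \<le> r" unfolding \<phi>_def using cINF_lower[OF bb rR, of t] by simp
        then show "\<phi> t \<le> x + e" using r by simp
      qed
      show ?case using 1 2 g_le[OF x, of t] elim by (auto simp: indicator_def)
    qed
  qed
  have ind_int: "integrable unif (indicat_real {t. \<phi> t < x})" "integrable unif (indicat_real {t. \<phi> t \<le> x})" for x
    by (rule integrable_const_bound[of _ 1]; auto)+
  have ge1: "measure unif {t. \<phi> t < x} \<le> x" if x: "x \<in> {0..1}" for x
  proof -
    have "measure unif {t. \<phi> t < x} = (LINT t|unif. indicator {t. \<phi> t < x} t)" by simp
    also have "\<dots> \<le> (LINT t|unif. g x t)"
      using sandwich[OF x] g_int[OF x] ind_int by (intro integral_mono_AE) (auto elim!: eventually_mono)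
    finally show ?thesis using g_int[OF x] by simp
  qed
  have le1: "x \<le> measure unif {t. \<phi> t \<le> x}" if x: "x \<in> {0..1}" "x < 1" for x
  proof -
    have "(LINT t|unif. g x t) \<le> (LINT t|unif. indicator {t. \<phi> t \<le> x} t)"
      using sandwich[OF x(1)] g_int[OF x(1)] ind_int x(2) by (intro integral_mono_AE) (auto elim!: eventually_mono)
    then show ?thesis using g_int[OF x(1)] by simp
  qed
  have \<phi>1: "\<phi> t \<le> 1" for t
    unfolding \<phi>_def using cINF_lower[OF bb R(4), of t] by auto
  have eq: "measure unif {t. \<phi> t \<le> x} = x" if x: "x \<in> {0..1}" for x
  proof (cases "x = 1")
    case True then show ?thesis using \<phi>1 prob_space by simp
  next
    case False
    have "measure unif {t. \<phi> t \<le> x} \<le> x"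
    proof (rule field_le_epsilon)
      fix e :: real assume e: "e > 0"
      define y where "y = min 1 (x + e)"
      have y: "y \<in> {0..1}" "x < y" "y \<le> x + e" using x e False by (auto simp: y_def)
      have "measure unif {t. \<phi> t \<le> x} \<le> measure unif {t. \<phi> t < y}"
        using y by (intro finite_measure_mono) auto
      then show "measure unif {t. \<phi> t \<le> x} \<le> x + e" using ge1[OF y(1)] y by simp
    qed
    then show ?thesis using le1[OF x] x False by auto
  qed
  have d: "distr unif borel \<phi> = unif"
  proof (rule real_distribution_eq_unifI)
    show "real_distribution (distr unif borel \<phi>)" by simp
    fix u :: real assume "u \<in> {0..1}"
    then show "cdf (distr unif borel \<phi>) u = u"
      unfolding cdf_def using eq[of u] by (subst measure_distr) (auto simp: vimage_def)
  qed
  have no_atom: "AE t in unif. \<phi> t \<noteq> x" for x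
  proof -
    have "AE s in distr unif borel \<phi>. s \<noteq> x" unfolding d AE_unif using AE_lborel_singleton[of x] by eventually_elim simp
    then show ?thesis by (subst (asm) AE_distr_iff) auto
  qed
  show thesis
  proof (rule that[OF \<phi>_m d])
    fix x :: real assume x: "x \<in> {0..1}"
    show "AE t in unif. deriv (\<lambda>s. U x s) t = indicator {t. \<phi> t \<le> x} t"
      using sandwich[OF x] g_d[OF x] no_atom[of x]
    proof eventually_elim
      case (elim t)
      show ?case
        using elim g_le[OF x, of t] \<phi>1[of t] x by (cases "x = 1") (auto simp: indicator_def split: if_splits)
    qed
  qed
qed

text \<open>
Integrating the derivative recovers the section.
\<close>

lemma copula_eq_joint_cdf_of_measure_preserving:
  assumes U: "copula U" and \<phi>: "\<phi> \<in> borel_measurable borel"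
    and x: "x \<in> {0..1}" and ae: "AE t in unif. deriv (\<lambda>s. U x s) t = indicator {t. \<phi> t \<le> x} t"
    and y: "y \<in> {0..1}"
  shows "measure unif {t. t \<le> y \<and> \<phi> t \<le> x} = U x y"
proof -
  note [measurable] = \<phi>
  obtain g where g: "g \<in> borel_measurable borel" "\<And>t. 0 \<le> g t \<and> g t \<le> 1"
    "AE t in unif. deriv (\<lambda>s. U x s) t = g t"
    "\<And>s. s \<in> {0..1} \<Longrightarrow> measure (density unif (\<lambda>t. ennreal (g t))) {..s} = U x s"
    using copula_section[OF U x] by metis
  note [measurable] = g(1)
  have "measure unif {t. t \<le> y \<and> \<phi> t \<le> x} = (LINT t|unif. indicator {t. t \<le> y \<and> \<phi> t \<le> x} t)"
    by simp
  also have "\<dots> = (LINT t|unif. indicator {..y} t * g t)"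
  proof (rule integral_cong_AE)
    show "AE t in unif. indicator {t. t \<le> y \<and> \<phi> t \<le> x} t = indicator {..y} t * g t"
      using ae g(3) by eventually_elim (auto simp: indicator_def)
  qed measurable
  also have "\<dots> = U x y" by (rule section_integral[OF g(1,2) g(4)[OF y]])
  finally show ?thesis .
qed

text \<open>
Applied to \<open>U\<close> and to its transpose, the construction yields two maps \<open>\<phi>\<close> and \<open>\<theta>\<close>.  For uniform \<open>t\<close>,
the pairs \<open>(\<phi> t, t)\<close> and \<open>(t, \<theta> t)\<close> both have \<open>U\<close> as their joint distribution function, hence the
same law; so the first pair also lies on the graph of \<open>\<theta>\<close> almost surely.
\<close>

lemma invertible_copula_representation:
  assumes inv: "invertible_copula U"
  shows "\<exists>\<phi> \<theta> :: real \<Rightarrow> real. \<phi> \<in> borel_measurable borel \<and> distr unif borel \<phi> = unif \<and>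
    \<theta> \<in> borel_measurable borel \<and>
    (\<forall>x\<in>{0..1}. AE t in unif. deriv (\<lambda>s. U x s) t = indicator {t. \<phi> t \<le> x} t) \<and>
    (AE t in unif. \<theta> (\<phi> t) = t)"
proof -
  obtain D where U: "copula U" and D: "copula D" and UD: "copula_eq (copula_prod U D) min_copula"
    and DU: "copula_eq (copula_prod D U) min_copula"
    using inv unfolding invertible_copula_def by blast
  let ?U = "\<lambda>x y. U y x" and ?D = "\<lambda>x y. D y x"
  have UD': "copula_eq (copula_prod ?U ?D) min_copula"
    by (rule copula_prod_eq_min_transpose[OF DU])
  interpret prob_space unif by (rule prob_space_unif)
  obtain \<phi> where \<phi>: "\<phi> \<in> borel_measurable borel" "distr unif borel \<phi> = unif"
    "\<And>x. x \<in> {0..1} \<Longrightarrow> AE t in unif. deriv (\<lambda>s. U x s) t = indicator {t. \<phi> t \<le> x} t"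
    using exists_measure_preserving_of_zero_one_sections[OF U inverse_section_zero_one[OF U D UD]] by metis
  obtain \<theta> where \<theta>: "\<theta> \<in> borel_measurable borel" "distr unif borel \<theta> = unif"
    "\<And>x. x \<in> {0..1} \<Longrightarrow> AE t in unif. deriv (\<lambda>s. U s x) t = indicator {t. \<theta> t \<le> x} t"
    using exists_measure_preserving_of_zero_one_sections[OF copula_transpose[OF U]
        inverse_section_zero_one[OF copula_transpose[OF U] copula_transpose[OF D] UD']] by metis
  note [measurable] = \<phi>(1) \<theta>(1)
  have u_id: "uniform_rv unif (\<lambda>t. t)" by (simp add: uniform_rv_def distr_id2)
  have p1: "uniform_pair unif \<phi> (\<lambda>t. t) U"
    unfolding uniform_pair_def uniform_rv_def
    using \<phi> u_id copula_eq_joint_cdf_of_measure_preserving[OF U \<phi>(1) _ \<phi>(3)]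
    by (auto simp: uniform_rv_def conj_commute)
  have p2: "uniform_pair unif (\<lambda>t. t) \<theta> U"
    unfolding uniform_pair_def uniform_rv_def
    using \<theta> u_id copula_eq_joint_cdf_of_measure_preserving[OF copula_transpose[OF U] \<theta>(1) _ \<theta>(3)]
    by (auto simp: uniform_rv_def)
  have law: "distr unif borel (\<lambda>t. (\<phi> t, t)) = distr unif borel (\<lambda>t. (t, \<theta> t))"
    using uniform_pair_joint_law[OF prob_space_unif p1 prob_space_unif p2] by (simp add: copula_eq_def)
  have "{p \<in> space (borel \<Otimes>\<^sub>M borel). \<theta> (fst p) = snd p} \<in> sets (borel \<Otimes>\<^sub>M borel)"
    by measurable
  then have S: "{p::real \<times> real. \<theta> (fst p) = snd p} \<in> sets borel"
    unfolding borel_prod[symmetric] by (simp add: space_pair_measure)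
  have m: "(\<lambda>t. (t, \<theta> t)) \<in> unif \<rightarrow>\<^sub>M borel" "(\<lambda>t. (\<phi> t, t)) \<in> unif \<rightarrow>\<^sub>M borel"
    by (auto intro!: measurable_Pair_borel)
  have "AE p in distr unif borel (\<lambda>t. (t, \<theta> t)). \<theta> (fst p) = snd p"
    using S m by (subst AE_distr_iff) auto
  then have "AE t in unif. \<theta> (\<phi> t) = t"
    unfolding law[symmetric] using S m by (subst (asm) AE_distr_iff) auto
  then show ?thesis using \<phi> \<theta>(1) by blast
qed

text \<open>
By the hypothesis on the derivative, the integral defining the product at \<open>(u, v)\<close> is the conditional
probability of \<open>Q \<le> v\<close> integrated over the event \<open>\<phi> t \<le> u\<close>.
\<close>

lemma uniform_pair_prod_left:
  assumes M: "prob_space M" and PQ: "uniform_pair M P Q A"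
    and \<phi>: "\<phi> \<in> borel_measurable borel" "distr unif borel \<phi> = unif"
    and ae: "\<And>x. x \<in> {0..1} \<Longrightarrow> AE t in unif. deriv (\<lambda>s. U x s) t = indicator {t. \<phi> t \<le> x} t"
  shows "uniform_pair M (\<lambda>\<omega>. \<phi> (P \<omega>)) Q (copula_prod U A)"
  unfolding uniform_pair_def
proof (intro conjI ballI)
  show "uniform_rv M (\<lambda>\<omega>. \<phi> (P \<omega>))" "uniform_rv M Q"
    using PQ \<phi> by (auto simp: uniform_pair_def intro: uniform_rv_comp)
  fix u v :: real assume u: "u \<in> {0..1}" and v: "v \<in> {0..1}"
  have "{t. \<phi> t \<le> u} \<in> sets borel" using \<phi>(1) by measurable
  from integral_section_derivative[OF M PQ v this ae[OF u]]
  show "measure M {\<omega> \<in> space M. \<phi> (P \<omega>) \<le> u \<and> Q \<omega> \<le> v} = copula_prod U A u v"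
    unfolding copula_prod_def by simp
qed

lemma invertible_copula_transpose:
  assumes "invertible_copula V" shows "invertible_copula (\<lambda>x y. V y x)"
proof -
  obtain D where D: "copula V" "copula D" "copula_eq (copula_prod V D) min_copula" "copula_eq (copula_prod D V) min_copula"
    using assms unfolding invertible_copula_def by blast
  show ?thesis unfolding invertible_copula_def
    using copula_transpose[OF D(1)] copula_transpose[OF D(2)]
      copula_prod_eq_min_transpose[OF D(3)] copula_prod_eq_min_transpose[OF D(4)] by blast
qed

section \<open>The probability integral transform\<close>

text \<open>
The quantile function extended by \<open>0\<close> to the whole line; on the unit interval it is adjoint to the
distribution function.
\<close>

lemma quantile_function:
  assumes N: "real_distribution N"
  obtains \<alpha> where "\<alpha> \<in> borel_measurable borel" "distr unif borel \<alpha> = N"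
    "\<And>u x. 0 < u \<Longrightarrow> u < 1 \<Longrightarrow> u \<le> cdf N x \<longleftrightarrow> \<alpha> u \<le> x"
proof -
  interpret cdf_distribution N by (rule cdf_distribution.intro[OF N])
  define \<alpha> where "\<alpha> u = (if u \<in> {0<..<1} then I u else 0)" for u
  have m [measurable]: "\<alpha> \<in> borel_measurable borel"
    unfolding \<alpha>_def by (subst measurable_If_restrict_space_iff) (simp_all add: measurable_CI Collect_mem_eq del: greaterThanLessThan_iff)
  have "distr unif borel \<alpha> = distr (restrict_space lborel {0<..<1}) borel I"
  proof (rule measure_eqI)
    fix A :: "real set" assume "A \<in> sets (distr unif borel \<alpha>)"
    then have A[measurable]: "A \<in> sets borel" by simp
    have "I \<in> borel_measurable (restrict_space lborel {0<..<1})"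
      using measurable_CI by (simp add: measurable_def space_restrict_space sets_restrict_space)
    then have "emeasure (distr (restrict_space lborel {0<..<1}) borel I) A
      = emeasure (restrict_space lborel {0<..<1}) (I -` A \<inter> {0<..<1})"
      by (subst emeasure_distr) (auto simp: space_restrict_space)
    also have "\<dots> = emeasure lborel (I -` A \<inter> {0<..<1})"
      by (subst emeasure_restrict_space) auto
    also have "I -` A \<inter> {0<..<1} = {0<..<1} \<inter> (\<alpha> -` A)" by (auto simp: \<alpha>_def)
    also have "emeasure lborel \<dots> = emeasure unif (\<alpha> -` A)"
      by (subst emeasure_unif) (auto intro!: measurable_sets_borel[OF m])
    also have "\<dots> = emeasure (distr unif borel \<alpha>) A"
      by (subst emeasure_distr) auto
    finally show "emeasure (distr unif borel \<alpha>) A = emeasure (distr (restrict_space lborel {0<..<1}) borel I) A" by simp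
  qed simp
  then have "distr unif borel \<alpha> = N" using distr_I_eq_M by simp
  moreover have "u \<le> cdf N x \<longleftrightarrow> \<alpha> u \<le> x" if "0 < u" "u < 1" for u x
  proof -
    have "\<alpha> u = I u" using that by (simp add: \<alpha>_def)
    then show ?thesis using pseudoinverse[OF that, of x] by (simp only:)
  qed
  ultimately show thesis using that m by blast
qed

text \<open>
If \<open>F\<close> is continuous, then \<open>F (\<alpha> u) = u\<close> for the quantile function \<open>\<alpha>\<close>.  Since the law of \<open>X\<close> is the
image of the uniform law under \<open>\<alpha>\<close>, this identity gives at once that \<open>F (X)\<close> is uniform and that
\<open>\<alpha>\<close> recovers \<open>X\<close> from it.
\<close>

lemma probability_integral_transform:
  assumes M: "prob_space M" and X: "continuous_rv M X"
  defines "F \<equiv> cdf (distr M borel X)"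
  obtains \<alpha> where "\<alpha> \<in> borel_measurable borel" "F \<in> borel_measurable borel"
    "\<And>u x. 0 < u \<Longrightarrow> u < 1 \<Longrightarrow> u \<le> F x \<longleftrightarrow> \<alpha> u \<le> x"
    "\<And>u. 0 < u \<Longrightarrow> u < 1 \<Longrightarrow> F (\<alpha> u) = u"
    "uniform_rv M (\<lambda>\<omega>. F (X \<omega>))" "AE \<omega> in M. \<alpha> (F (X \<omega>)) = X \<omega>"
proof -
  interpret prob_space M by fact
  have [measurable]: "X \<in> borel_measurable M" and cont: "continuous_on UNIV F"
    using X by (auto simp: continuous_rv_def F_def)
  define N where "N = distr M borel X"
  have N: "real_distribution N" unfolding N_def by (intro real_distribution_distr) measurable
  have F: "F = cdf N" by (simp add: F_def N_def)
  have F_m [measurable]: "F \<in> borel_measurable borel" using cont by (rule borel_measurable_continuous_onI)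
  obtain \<alpha> where \<alpha> [measurable]: "\<alpha> \<in> borel_measurable borel" and d: "distr unif borel \<alpha> = N"
    and gal: "\<And>u x. 0 < u \<Longrightarrow> u < 1 \<Longrightarrow> u \<le> F x \<longleftrightarrow> \<alpha> u \<le> x"
    using quantile_function[OF N] unfolding F by metis
  have F\<alpha>: "F (\<alpha> u) = u" if u: "0 < u" "u < 1" for u
  proof (rule antisym)
    show "u \<le> F (\<alpha> u)" using gal[OF u] by simp
    show "F (\<alpha> u) \<le> u"
    proof (rule ccontr)
      assume "\<not> F (\<alpha> u) \<le> u"
      then have "u < F (\<alpha> u)" by simp
      moreover have "isCont F (\<alpha> u)" using cont by (simp add: continuous_on_eq_continuous_at)
      ultimately have "eventually (\<lambda>x. u < F x) (at_left (\<alpha> u))"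
        by (auto simp: isCont_def intro: order_tendstoD filterlim_at_split[THEN iffD1, THEN conjunct1])
      then obtain b where b: "b < \<alpha> u" "\<And>x. b < x \<Longrightarrow> x < \<alpha> u \<Longrightarrow> u < F x"
        using eventually_at_left[of "\<alpha> u - 1" "\<alpha> u"] by auto
      then obtain x where "x < \<alpha> u" "u < F x" using dense by blast
      then show False using gal[OF u, of x] by simp
    qed
  qed
  have dF: "distr M borel (\<lambda>\<omega>. F (X \<omega>)) = unif"
  proof -
    have "distr M borel (\<lambda>\<omega>. F (X \<omega>)) = distr N borel F"
      unfolding N_def by (subst distr_distr) (auto simp: o_def)
    also have "\<dots> = distr unif borel (\<lambda>u. F (\<alpha> u))"
      unfolding d[symmetric] by (subst distr_distr) (auto simp: o_def)
    also have "\<dots> = distr unif borel (\<lambda>u. u)"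
      by (intro distr_cong_AE) (auto simp: AE_unif F\<alpha>)
    finally show ?thesis by (simp add: distr_id2)
  qed
  have "AE u in unif. \<alpha> (F (\<alpha> u)) = \<alpha> u" by (simp add: AE_unif F\<alpha>)
  then have "AE x in distr unif borel \<alpha>. \<alpha> (F x) = x" by (subst AE_distr_iff) auto
  then have "AE \<omega> in M. \<alpha> (F (X \<omega>)) = X \<omega>"
    unfolding d N_def by (subst (asm) AE_distr_iff) auto
  then show thesis using that[OF \<alpha> F_m gal F\<alpha>] dF by (simp add: uniform_rv_def)
qed

section \<open>Borel bijections between variables that determine each other\<close>

text \<open>
Take for \<open>c\<close> the distribution function of a law that charges exactly the rational numbers, all of
them.  It is strictly increasing, and \<open>c'\<close> is its quantile function.  If \<open>u = c x\<close> lies in the range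
and \<open>c' u = x\<close> is rational, then \<open>u\<close> is in the countable set \<open>c ` \<rat>\<close>; and \<open>c' u\<close> is rational for
almost every \<open>u\<close> because \<open>c'\<close> maps the uniform law to the discrete one.

The range is described as the set of \<open>u\<close> with \<open>c (c' u) = u\<close>, which is visibly Borel.
\<close>

lemma borel_embedding_into_lebesgue_null_set:
  obtains c c' :: "real \<Rightarrow> real"
  where "c \<in> borel_measurable borel" "c' \<in> borel_measurable borel" "\<And>x. 0 < c x \<and> c x < 1" "\<And>x. c' (c x) = x"
    "AE u in unif. c (c' u) \<noteq> u"
proof -
  define q where "q = map_pmf (from_nat :: nat \<Rightarrow> rat) (geometric_pmf (1/2))"
  have q: "pmf q r > 0" for r
  proof -
    have "r \<in> set_pmf q" unfolding q_def by (simp add: set_pmf_geometric)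
    then show ?thesis by (simp add: set_pmf_iff pmf_positive)
  qed
  define N where "N = distr (measure_pmf q) borel (of_rat :: rat \<Rightarrow> real)"
  have N: "real_distribution N" unfolding N_def by (intro prob_space.real_distribution_distr measure_pmf.prob_space_axioms) simp
  interpret real_distribution N by fact
  have cdfN: "cdf N x = measure_pmf.prob q {r. of_rat r \<le> x}" for x
    unfolding cdf_def N_def by (subst measure_distr) (auto simp: vimage_def)
  have sm: "cdf N x < cdf N y" if "x < y" for x y
  proof -
    obtain r where r: "x < of_rat r" "of_rat r < y" using of_rat_dense[OF \<open>x < y\<close>] by blast
    have "cdf N x < cdf N x + pmf q r" using q by simp
    also have "\<dots> = measure_pmf.prob q ({r. of_rat r \<le> x} \<union> {r})"
      unfolding cdfN using r by (subst measure_pmf.finite_measure_Union) (auto simp: measure_pmf_single)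
    also have "\<dots> \<le> cdf N y"
      unfolding cdfN using r that by (intro measure_pmf.finite_measure_mono) auto
    finally show ?thesis .
  qed
  have c01: "0 < cdf N x \<and> cdf N x < 1" for x
    using sm[of "x - 1" x] sm[of x "x + 1"] cdf_nonneg[of "x - 1"] cdf_bounded_prob[of "x + 1"] by linarith
  obtain \<alpha> where \<alpha> [measurable]: "\<alpha> \<in> borel_measurable borel" and d: "distr unif borel \<alpha> = N"
    and gal: "\<And>u x. 0 < u \<Longrightarrow> u < 1 \<Longrightarrow> u \<le> cdf N x \<longleftrightarrow> \<alpha> u \<le> x"
    using quantile_function[OF N] by metis
  have inv: "\<alpha> (cdf N x) = x" for x
  proof (rule antisym)
    show "\<alpha> (cdf N x) \<le> x" using gal[of "cdf N x" x] c01 by simp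
    show "x \<le> \<alpha> (cdf N x)"
      using gal[of "cdf N x" "\<alpha> (cdf N x)"] c01 sm[of "\<alpha> (cdf N x)" x] by force
  qed
  have cm: "cdf N \<in> borel_measurable borel"
    by (intro borel_measurable_mono monoI cdf_nondecreasing)
  have Q: "(\<rat> :: real set) \<in> sets borel" by (rule sets.countable[OF _ countable_rat]) auto
  then have "AE x in N. x \<in> \<rat>"
    unfolding N_def by (subst AE_distr_iff) auto
  then have "AE u in unif. \<alpha> u \<in> \<rat>"
    unfolding d[symmetric] using Q by (subst (asm) AE_distr_iff) auto
  moreover have "AE u in unif. u \<notin> cdf N ` \<rat>"
  proof -
    have "countable (cdf N ` \<rat>)" by (intro countable_image countable_rat)
    then have "AE u in lborel. u \<notin> cdf N ` \<rat>" by (intro AE_not_in countable_imp_null_set_lborel)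
    then show ?thesis unfolding AE_unif by eventually_elim simp
  qed
  ultimately have "AE u in unif. cdf N (\<alpha> u) \<noteq> u"
    by eventually_elim (metis imageI)
  then show thesis using that[OF cm \<alpha> c01 inv] by blast
qed

text \<open>
Both the domain and the target of the bijections to be built must have room for the exceptional sets.
The range of \<open>e\<close> is an uncountable Borel set that \<open>X\<close> misses almost surely.
\<close>

lemma borel_embedding_into_null_set:
  assumes M: "prob_space M" and X: "continuous_rv M X"
  shows "\<exists>e e' :: real \<Rightarrow> real. e \<in> borel_measurable borel \<and> e' \<in> borel_measurable borel \<and>
    (\<forall>x. e' (e x) = x) \<and> (AE \<omega> in M. e (e' (X \<omega>)) \<noteq> X \<omega>)"
proof -
  define F where "F = cdf (distr M borel X)"
  obtain \<alpha> where \<alpha>: "\<alpha> \<in> borel_measurable borel" "F \<in> borel_measurable borel"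
    "\<And>u. 0 < u \<Longrightarrow> u < 1 \<Longrightarrow> F (\<alpha> u) = u" "uniform_rv M (\<lambda>\<omega>. F (X \<omega>))"
    using probability_integral_transform[OF M X] unfolding F_def by metis
  obtain c c' :: "real \<Rightarrow> real" where c: "c \<in> borel_measurable borel" "c' \<in> borel_measurable borel"
    "\<And>x. 0 < c x \<and> c x < 1" "\<And>x. c' (c x) = x" "AE u in unif. c (c' u) \<noteq> u"
    by (rule borel_embedding_into_lebesgue_null_set) (rule that)
  note [measurable] = \<alpha>(1,2) c(1,2)
  have X_m [measurable]: "X \<in> borel_measurable M" using X by (simp add: continuous_rv_def)
  have dF: "distr M borel (\<lambda>\<omega>. F (X \<omega>)) = unif"
    using \<alpha>(4) by (simp add: uniform_rv_def)
  have "AE u in distr M borel (\<lambda>\<omega>. F (X \<omega>)). c (c' u) \<noteq> u"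
    unfolding dF by (rule c(5))
  then have ae: "AE \<omega> in M. c (c' (F (X \<omega>))) \<noteq> F (X \<omega>)"
    by (subst (asm) AE_distr_iff) auto
  have "AE \<omega> in M. \<alpha> (c (c' (F (X \<omega>)))) \<noteq> X \<omega>"
    using ae by eventually_elim (metis \<alpha>(3) c(3))
  then show ?thesis
    by (intro exI[of _ "\<lambda>x. \<alpha> (c x)"] exI[of _ "\<lambda>x. c' (F x)"]) (simp add: \<alpha>(3) c(3,4))
qed

text \<open>
The Schroeder-Bernstein construction: shift by \<open>e\<close> on the orbits of the complement of \<open>P\<close>, and do
nothing elsewhere.  Images of Borel sets under \<open>e\<close> are Borel because \<open>e\<close> has a Borel left inverse.
\<close>

lemma borel_isomorphism_onto_superset_of_embedding:
  fixes e e' :: "real \<Rightarrow> real"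
  assumes e [measurable]: "e \<in> borel_measurable borel" "e' \<in> borel_measurable borel" and inv: "\<And>x. e' (e x) = x"
    and P [measurable]: "P \<in> sets borel" and sub: "range e \<subseteq> P"
  shows "\<exists>k k' :: real \<Rightarrow> real. k \<in> borel_measurable borel \<and> k' \<in> borel_measurable borel \<and>
    (\<forall>x. k x \<in> P \<and> k' (k x) = x) \<and> (\<forall>x\<in>P. k (k' x) = x)"
proof -
  have image: "e ` B \<in> sets borel" if [measurable]: "B \<in> sets borel" for B
  proof -
    have "e ` B = {y. e (e' y) = y \<and> e' y \<in> B}" using inv by (auto simp: image_iff) metis
    also have "\<dots> \<in> sets borel" by measurable
    finally show ?thesis .
  qed
  have "(e ^^ n) ` (- P) \<in> sets borel" for n
  proof (induction n)
    case (Suc n)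
    have "(e ^^ Suc n) ` (- P) = e ` ((e ^^ n) ` (- P))" by (simp add: image_comp)
    then show ?case using image[OF Suc] by simp
  qed (use P in \<open>simp add: borel_comp\<close>)
  then have S [measurable]: "(\<Union>n. (e ^^ n) ` (- P)) \<in> sets borel" by auto
  define S where "S = (\<Union>n. (e ^^ n) ` (- P))"
  have [measurable]: "S \<in> sets borel" unfolding S_def by (rule S)
  have S0: "- P \<subseteq> S" unfolding S_def by (rule order.trans[OF _ UN_upper[of 0]]) auto
  have S1: "e x \<in> S" if "x \<in> S" for x
  proof -
    obtain n z where "z \<notin> P" "x = (e ^^ n) z" using \<open>x \<in> S\<close> by (auto simp: S_def)
    then have "e x = (e ^^ Suc n) z" "z \<in> - P" by auto
    then show ?thesis unfolding S_def by blast
  qed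
  have S2: "\<exists>w\<in>S. x = e w" if x: "x \<in> S" "x \<in> P" for x
  proof -
    obtain n z where z: "z \<notin> P" "x = (e ^^ n) z" using x by (auto simp: S_def)
    with x obtain m where "n = Suc m" by (cases n) auto
    then have "x = e ((e ^^ m) z)" "(e ^^ m) z \<in> S" using z by (auto simp: S_def)
    then show ?thesis by blast
  qed
  define k where "k x = (if x \<in> S then e x else x)" for x
  define k' where "k' x = (if x \<in> S then e' x else x)" for x
  have "k \<in> borel_measurable borel" "k' \<in> borel_measurable borel"
    unfolding k_def k'_def by measurable
  moreover have "\<forall>x. k x \<in> P \<and> k' (k x) = x"
    using sub S0 S1 inv by (auto simp: k_def k'_def)
  moreover have "k (k' x) = x" if xP: "x \<in> P" for x
  proof (cases "x \<in> S")
    case True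
    then obtain w where "w \<in> S" "x = e w" using S2[OF True xP] by blast
    then show ?thesis using True by (simp add: k_def k'_def inv)
  qed (simp add: k_def k'_def)
  ultimately show ?thesis by - (rule exI[of _ k], rule exI[of _ k'], blast)
qed

text \<open>
The given functions restrict to inverse bijections between Borel sets \<open>A\<close> and \<open>B\<close> of full measure.
These are shrunk so that each complement contains a Borel copy of the line, hence is Borel
isomorphic to the line; composing the two isomorphisms gives a bijection of the complements.
\<close>

lemma mutually_completely_dependentI:
  assumes M: "prob_space M" and X: "continuous_rv M X" and Y: "continuous_rv M Y"
    and XY: "completely_dependent_on M X Y" and YX: "completely_dependent_on M Y X"
  shows "mutually_completely_dependent M X Y"
proof -
  obtain f where f [measurable]: "f \<in> borel_measurable borel" and fX: "AE \<omega> in M. Y \<omega> = f (X \<omega>)"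
    using YX by (auto simp: completely_dependent_on_def)
  obtain g where g [measurable]: "g \<in> borel_measurable borel" and gY: "AE \<omega> in M. X \<omega> = g (Y \<omega>)"
    using XY by (auto simp: completely_dependent_on_def)
  obtain e e' :: "real \<Rightarrow> real" where e [measurable]: "e \<in> borel_measurable borel" "e' \<in> borel_measurable borel" and e_inv: "\<And>x. e' (e x) = x"
    and e_null: "AE \<omega> in M. e (e' (X \<omega>)) \<noteq> X \<omega>"
    using borel_embedding_into_null_set[OF M X] by blast
  obtain d d' :: "real \<Rightarrow> real" where d [measurable]: "d \<in> borel_measurable borel" "d' \<in> borel_measurable borel" and d_inv: "\<And>x. d' (d x) = x"
    and d_null: "AE \<omega> in M. d (d' (Y \<omega>)) \<noteq> Y \<omega>"
    using borel_embedding_into_null_set[OF M Y] by blast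
  define A where "A = {x. g (f x) = x \<and> e (e' x) \<noteq> x \<and> d (d' (f x)) \<noteq> f x}"
  define B where "B = {y. f (g y) = y \<and> d (d' y) \<noteq> y \<and> e (e' (g y)) \<noteq> g y}"
  have [measurable]: "A \<in> sets borel" "B \<in> sets borel" unfolding A_def B_def by measurable
  have rA: "- A \<in> sets borel" "range e \<subseteq> - A" by (auto simp: borel_comp e_inv) (auto simp: A_def e_inv)
  have rB: "- B \<in> sets borel" "range d \<subseteq> - B" by (auto simp: borel_comp d_inv) (auto simp: B_def d_inv)
  obtain k k' :: "real \<Rightarrow> real" where k [measurable]: "k \<in> borel_measurable borel" "k' \<in> borel_measurable borel"
    and k_inv: "\<And>x. k x \<in> - A" "\<And>x. k' (k x) = x" "\<And>x. x \<in> - A \<Longrightarrow> k (k' x) = x"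
    using borel_isomorphism_onto_superset_of_embedding[OF e e_inv rA] by blast
  obtain l l' :: "real \<Rightarrow> real" where l [measurable]: "l \<in> borel_measurable borel" "l' \<in> borel_measurable borel"
    and l_inv: "\<And>x. l x \<in> - B" "\<And>x. l' (l x) = x" "\<And>x. x \<in> - B \<Longrightarrow> l (l' x) = x"
    using borel_isomorphism_onto_superset_of_embedding[OF d d_inv rB] by blast
  define h where "h x = (if x \<in> A then f x else l (k' x))" for x
  define h' where "h' y = (if y \<in> B then g y else k (l' y))" for y
  have fB: "f x \<in> B" "g (f x) = x" if "x \<in> A" for x using that by (auto simp: A_def B_def)
  have gA: "g y \<in> A" "f (g y) = y" if "y \<in> B" for y using that by (auto simp: A_def B_def)
  have "h' (h x) = x" for x
    using fB[of x] l_inv(1)[of "k' x"] l_inv(2) k_inv(3)[of x] by (auto simp: h_def h'_def)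
  moreover have "h (h' y) = y" for y
    using gA[of y] k_inv(1)[of "l' y"] k_inv(2) l_inv(3)[of y] by (auto simp: h_def h'_def)
  ultimately have "bij h" by (intro o_bij[of h' h]) auto
  moreover have "h \<in> borel_measurable borel" unfolding h_def by measurable
  moreover have "AE \<omega> in M. Y \<omega> = h (X \<omega>)"
    using fX gY e_null d_null
  proof eventually_elim
    case (elim \<omega>)
    then have "X \<omega> \<in> A" by (simp add: A_def)
    then have "h (X \<omega>) = f (X \<omega>)" by (simp add: h_def)
    then show ?case using elim(1) by simp
  qed
  ultimately show ?thesis unfolding mutually_completely_dependent_def by blast
qed

section \<open>Reshuffling and dependence\<close>

text \<open>
For \<open>u\<close> and \<open>v\<close> strictly between \<open>0\<close> and \<open>1\<close> the event \<open>F (X) \<le> u\<close> coincides almost surely with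
\<open>X \<le> \<alpha> u\<close>, by the adjunction between \<open>F\<close> and its quantile function \<open>\<alpha>\<close>.  At \<open>0\<close> and \<open>1\<close> the quantile
function is not available, and the boundary conditions of a copula are used.
\<close>

lemma uniform_pair_cdf_transform:
  assumes M: "prob_space M" and X: "continuous_rv M X" and Y: "continuous_rv M Y"
    and C: "is_copula_of M X Y C"
  shows "uniform_pair M (\<lambda>\<omega>. cdf (distr M borel X) (X \<omega>)) (\<lambda>\<omega>. cdf (distr M borel Y) (Y \<omega>)) C"
proof -
  interpret prob_space M by fact
  define F where "F = cdf (distr M borel X)"
  define G where "G = cdf (distr M borel Y)"
  have [measurable]: "X \<in> borel_measurable M" "Y \<in> borel_measurable M"
    using X Y by (auto simp: continuous_rv_def)
  obtain \<alpha> where F [measurable]: "F \<in> borel_measurable borel"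
    and Fgal: "\<And>u x. 0 < u \<Longrightarrow> u < 1 \<Longrightarrow> u \<le> F x \<longleftrightarrow> \<alpha> u \<le> x"
    and F\<alpha>: "\<And>u. 0 < u \<Longrightarrow> u < 1 \<Longrightarrow> F (\<alpha> u) = u"
    and UF: "uniform_rv M (\<lambda>\<omega>. F (X \<omega>))" and \<alpha>F: "AE \<omega> in M. \<alpha> (F (X \<omega>)) = X \<omega>"
    using probability_integral_transform[OF M X, folded F_def] by metis
  obtain \<beta> where G [measurable]: "G \<in> borel_measurable borel"
    and Ggal: "\<And>u x. 0 < u \<Longrightarrow> u < 1 \<Longrightarrow> u \<le> G x \<longleftrightarrow> \<beta> u \<le> x"
    and G\<beta>: "\<And>u. 0 < u \<Longrightarrow> u < 1 \<Longrightarrow> G (\<beta> u) = u"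
    and UG: "uniform_rv M (\<lambda>\<omega>. G (Y \<omega>))" and \<beta>G: "AE \<omega> in M. \<beta> (G (Y \<omega>)) = Y \<omega>"
    using probability_integral_transform[OF M Y, folded G_def] by metis
  have cop: "copula C" and H: "measure M {\<omega> \<in> space M. X \<omega> \<le> x \<and> Y \<omega> \<le> y} = C (F x) (G y)" for x y
    using C by (auto simp: is_copula_of_def F_def G_def)
  note F01 = uniform_rv_AE[OF UF] and G01 = uniform_rv_AE[OF UG]
  have "measure M {\<omega> \<in> space M. F (X \<omega>) \<le> u \<and> G (Y \<omega>) \<le> v} = C u v"
    if u: "u \<in> {0..1}" and v: "v \<in> {0..1}" for u v
  proof -
    have [simp]: "max 0 (min 1 u) = u" "max 0 (min 1 v) = v" using u v by auto
    consider "u = 0" | "v = 0" | "u = 1" | "v = 1" | "0 < u" "u < 1" "0 < v" "v < 1"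
      using u v unfolding atLeastAtMost_iff by linarith
    then show ?thesis
    proof cases
      case 1
      have "measure M {\<omega> \<in> space M. F (X \<omega>) \<le> u \<and> G (Y \<omega>) \<le> v} = measure M {}"
        using F01 1 by (intro finite_measure_eq_AE) auto
      then show ?thesis using copulaD[OF cop v] 1 by simp
    next
      case 2
      have "measure M {\<omega> \<in> space M. F (X \<omega>) \<le> u \<and> G (Y \<omega>) \<le> v} = measure M {}"
        using G01 2 by (intro finite_measure_eq_AE) auto
      then show ?thesis using copulaD[OF cop u] 2 by simp
    next
      case 3
      have "measure M {\<omega> \<in> space M. F (X \<omega>) \<le> u \<and> G (Y \<omega>) \<le> v} = measure M {\<omega> \<in> space M. G (Y \<omega>) \<le> v}"
        using F01 3 by (intro finite_measure_eq_AE) auto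
      then show ?thesis using copulaD[OF cop v] 3 by (simp add: uniform_rv_prob_le[OF UG])
    next
      case 4
      have "measure M {\<omega> \<in> space M. F (X \<omega>) \<le> u \<and> G (Y \<omega>) \<le> v} = measure M {\<omega> \<in> space M. F (X \<omega>) \<le> u}"
        using G01 4 by (intro finite_measure_eq_AE) auto
      then show ?thesis using copulaD[OF cop u] 4 by (simp add: uniform_rv_prob_le[OF UF])
    next
      case 5
      have "AE \<omega> in M. (F (X \<omega>) \<le> u \<longleftrightarrow> X \<omega> \<le> \<alpha> u) \<and> (G (Y \<omega>) \<le> v \<longleftrightarrow> Y \<omega> \<le> \<beta> v)"
        using F01 G01 \<alpha>F \<beta>G
      proof eventually_elim
        case (elim \<omega>)
        have "F (X \<omega>) \<le> u \<longleftrightarrow> \<alpha> (F (X \<omega>)) \<le> \<alpha> u"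
          using Fgal[of "F (X \<omega>)" "\<alpha> u"] F\<alpha>[OF 5(1,2)] elim by simp
        moreover have "G (Y \<omega>) \<le> v \<longleftrightarrow> \<beta> (G (Y \<omega>)) \<le> \<beta> v"
          using Ggal[of "G (Y \<omega>)" "\<beta> v"] G\<beta>[OF 5(3,4)] elim by simp
        ultimately show ?case using elim by simp
      qed
      then have "measure M {\<omega> \<in> space M. F (X \<omega>) \<le> u \<and> G (Y \<omega>) \<le> v}
          = measure M {\<omega> \<in> space M. X \<omega> \<le> \<alpha> u \<and> Y \<omega> \<le> \<beta> v}"
        by (intro finite_measure_eq_AE) auto
      then show ?thesis using H F\<alpha> G\<beta> 5 by simp
    qed
  qed
  then show ?thesis using UF UG by (simp add: uniform_pair_def F_def G_def)
qed

lemma completely_dependent_on_trans: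
  assumes "completely_dependent_on M Z Y" "completely_dependent_on M Y X"
  shows "completely_dependent_on M Z X"
proof -
  obtain g where [measurable]: "g \<in> borel_measurable borel" and g: "AE \<omega> in M. Z \<omega> = g (Y \<omega>)"
    using assms(1) by (auto simp: completely_dependent_on_def)
  obtain h where [measurable]: "h \<in> borel_measurable borel" and h: "AE \<omega> in M. Y \<omega> = h (X \<omega>)"
    using assms(2) by (auto simp: completely_dependent_on_def)
  have "AE \<omega> in M. Z \<omega> = g (h (X \<omega>))" using g h by eventually_elim simp
  then show ?thesis unfolding completely_dependent_on_def
    by (intro exI[of _ "\<lambda>x. g (h x)"]) simp
qed

lemma mutually_completely_dependent_trans:
  assumes "mutually_completely_dependent M X Y" "mutually_completely_dependent M Y Z"
  shows "mutually_completely_dependent M X Z"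
proof -
  obtain g where [measurable]: "g \<in> borel_measurable borel" and g: "bij g" "AE \<omega> in M. Z \<omega> = g (Y \<omega>)"
    using assms(2) by (auto simp: mutually_completely_dependent_def)
  obtain h where [measurable]: "h \<in> borel_measurable borel" and h: "bij h" "AE \<omega> in M. Y \<omega> = h (X \<omega>)"
    using assms(1) by (auto simp: mutually_completely_dependent_def)
  have "AE \<omega> in M. Z \<omega> = (g \<circ> h) (X \<omega>)" using g(2) h(2) by eventually_elim simp
  moreover have "bij (g \<circ> h)" using g h by (intro bij_comp)
  moreover have "g \<circ> h \<in> borel_measurable borel" by (simp add: o_def)
  ultimately show ?thesis unfolding mutually_completely_dependent_def by blast
qed

lemma completely_dependent_cdf_transform:
  assumes M: "prob_space M" and X: "continuous_rv M X"
  shows "completely_dependent_on M (\<lambda>\<omega>. cdf (distr M borel X) (X \<omega>)) X"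
    and "completely_dependent_on M X (\<lambda>\<omega>. cdf (distr M borel X) (X \<omega>))"
proof -
  obtain \<alpha> where \<alpha>: "\<alpha> \<in> borel_measurable borel" and F: "cdf (distr M borel X) \<in> borel_measurable borel"
     and inv: "AE \<omega> in M. \<alpha> (cdf (distr M borel X) (X \<omega>)) = X \<omega>"
    using probability_integral_transform[OF M X] by metis
  show "completely_dependent_on M (\<lambda>\<omega>. cdf (distr M borel X) (X \<omega>)) X"
    unfolding completely_dependent_on_def using F by (intro exI[of _ "cdf (distr M borel X)"]) simp
  have "AE \<omega> in M. X \<omega> = \<alpha> (cdf (distr M borel X) (X \<omega>))"
    using inv by eventually_elim simp
  then show "completely_dependent_on M X (\<lambda>\<omega>. cdf (distr M borel X) (X \<omega>))"
    unfolding completely_dependent_on_def using \<alpha> by blast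
qed

lemma completely_dependent_measure_preserving:
  assumes P: "uniform_rv M P" and \<phi>: "\<phi> \<in> borel_measurable borel" "\<theta> \<in> borel_measurable borel"
    and inv: "AE t in unif. \<theta> (\<phi> t) = t"
  shows "completely_dependent_on M (\<lambda>\<omega>. \<phi> (P \<omega>)) P"
    and "completely_dependent_on M P (\<lambda>\<omega>. \<phi> (P \<omega>))"
proof -
  note [measurable] = \<phi>
  have [measurable]: "P \<in> borel_measurable M" and d: "distr M borel P = unif"
    using P by (auto simp: uniform_rv_def)
  show "completely_dependent_on M (\<lambda>\<omega>. \<phi> (P \<omega>)) P"
    unfolding completely_dependent_on_def using \<phi>(1) by (intro exI[of _ \<phi>]) simp
  have "AE \<omega> in M. \<theta> (\<phi> (P \<omega>)) = P \<omega>"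
    using inv unfolding d[symmetric] by (subst (asm) AE_distr_iff) auto
  then have "AE \<omega> in M. P \<omega> = \<theta> (\<phi> (P \<omega>))" by eventually_elim simp
  then show "completely_dependent_on M P (\<lambda>\<omega>. \<phi> (P \<omega>))"
    unfolding completely_dependent_on_def using \<phi>(2) by blast
qed

lemma copula_S_representation:
  assumes M: "prob_space M" and X: "continuous_rv M X" and Y: "continuous_rv M Y"
    and C: "is_copula_of M X Y C" and U: "invertible_copula U" and V: "invertible_copula V"
  obtains X' Y' where "uniform_pair M X' Y' (copula_S U V C)"
    "completely_dependent_on M X' X" "completely_dependent_on M X X'"
    "completely_dependent_on M Y' Y" "completely_dependent_on M Y Y'"
proof -
  define P where "P \<omega> = cdf (distr M borel X) (X \<omega>)" for \<omega>
  define Q where "Q \<omega> = cdf (distr M borel Y) (Y \<omega>)" for \<omega>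
  have PQ: "uniform_pair M P Q C"
    using uniform_pair_cdf_transform[OF M X Y C] by (simp add: P_def[abs_def] Q_def[abs_def])
  then have unif: "uniform_rv M P" "uniform_rv M Q" by (auto simp: uniform_pair_def)
  obtain \<phi> \<phi>' :: "real \<Rightarrow> real" where \<phi>: "\<phi> \<in> borel_measurable borel" "distr unif borel \<phi> = unif" "\<phi>' \<in> borel_measurable borel"
    "\<And>x. x \<in> {0..1} \<Longrightarrow> AE t in unif. deriv (\<lambda>s. U x s) t = indicator {t. \<phi> t \<le> x} t"
    "AE t in unif. \<phi>' (\<phi> t) = t"
    using invertible_copula_representation[OF U] by blast
  obtain \<psi> \<psi>' :: "real \<Rightarrow> real" where \<psi>: "\<psi> \<in> borel_measurable borel" "distr unif borel \<psi> = unif" "\<psi>' \<in> borel_measurable borel"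
    "\<And>x. x \<in> {0..1} \<Longrightarrow> AE t in unif. deriv (\<lambda>s. V s x) t = indicator {t. \<psi> t \<le> x} t"
    "AE t in unif. \<psi>' (\<psi> t) = t"
    using invertible_copula_representation[OF invertible_copula_transpose[OF V]] by blast
  have 1: "uniform_pair M (\<lambda>\<omega>. \<phi> (P \<omega>)) Q (copula_prod U C)"
    by (rule uniform_pair_prod_left[OF M PQ \<phi>(1,2,4)])
  have "uniform_pair M (\<lambda>\<omega>. \<psi> (Q \<omega>)) (\<lambda>\<omega>. \<phi> (P \<omega>)) (copula_prod (\<lambda>x y. V y x) (\<lambda>x y. copula_prod U C y x))"
    by (rule uniform_pair_prod_left[OF M uniform_pair_transpose[OF 1] \<psi>(1,2,4)])
  from uniform_pair_transpose[OF this]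
  have 2: "uniform_pair M (\<lambda>\<omega>. \<phi> (P \<omega>)) (\<lambda>\<omega>. \<psi> (Q \<omega>)) (copula_S U V C)"
    unfolding copula_S_def copula_prod_transpose[of "copula_prod U C" V, symmetric] .
  show thesis
  proof (rule that[OF 2])
    have "completely_dependent_on M P X" "completely_dependent_on M X P"
      using completely_dependent_cdf_transform[OF M X] by (simp_all add: P_def[abs_def])
    then show "completely_dependent_on M (\<lambda>\<omega>. \<phi> (P \<omega>)) X" "completely_dependent_on M X (\<lambda>\<omega>. \<phi> (P \<omega>))"
      using completely_dependent_measure_preserving[OF unif(1) \<phi>(1,3,5)] completely_dependent_on_trans by blast+
    have "completely_dependent_on M Q Y" "completely_dependent_on M Y Q"
      using completely_dependent_cdf_transform[OF M Y] by (simp_all add: Q_def[abs_def])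
    then show "completely_dependent_on M (\<lambda>\<omega>. \<psi> (Q \<omega>)) Y" "completely_dependent_on M Y (\<lambda>\<omega>. \<psi> (Q \<omega>))"
      using completely_dependent_measure_preserving[OF unif(2) \<psi>(1,3,5)] completely_dependent_on_trans by blast+
  qed
qed

lemma indep_var_iff_joint_cdf:
  assumes M: "prob_space M" and P [measurable]: "P \<in> borel_measurable M" and Q [measurable]: "Q \<in> borel_measurable M"
  shows "prob_space.indep_var M borel P borel Q \<longleftrightarrow>
    (\<forall>x y :: real. measure M {\<omega> \<in> space M. P \<omega> \<le> x \<and> Q \<omega> \<le> y}
       = measure M {\<omega> \<in> space M. P \<omega> \<le> x} * measure M {\<omega> \<in> space M. Q \<omega> \<le> y})"
proof -
  interpret prob_space M by fact
  show ?thesis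
  proof (intro iffI allI)
    fix x y :: real assume "indep_var borel P borel Q"
    from indep_varD[OF this, of "{..x}" "{..y}"]
    show "prob {\<omega> \<in> space M. P \<omega> \<le> x \<and> Q \<omega> \<le> y} = prob {\<omega> \<in> space M. P \<omega> \<le> x} * prob {\<omega> \<in> space M. Q \<omega> \<le> y}"
      by (simp add: vimage_def Int_def conj_commute)
  next
    assume eq: "\<forall>x y. prob {\<omega> \<in> space M. P \<omega> \<le> x \<and> Q \<omega> \<le> y} = prob {\<omega> \<in> space M. P \<omega> \<le> x} * prob {\<omega> \<in> space M. Q \<omega> \<le> y}"
    interpret P: prob_space "distr M borel P" by (rule prob_space_distr) measurable
    interpret Q: prob_space "distr M borel Q" by (rule prob_space_distr) measurable
    interpret PQ: pair_prob_space "distr M borel P" "distr M borel Q" ..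
    have "distr M borel P \<Otimes>\<^sub>M distr M borel Q = distr M borel (\<lambda>\<omega>. (P \<omega>, Q \<omega>))"
    proof (rule joint_law_eqI)
      show "prob_space (distr M borel P \<Otimes>\<^sub>M distr M borel Q)" by (rule PQ.prob_space_axioms)
      show "prob_space (distr M borel (\<lambda>\<omega>. (P \<omega>, Q \<omega>)))"
        by (intro prob_space_distr measurable_Pair_borel P Q)
      show "sets (distr M borel P \<Otimes>\<^sub>M distr M borel Q) = sets borel"
        unfolding borel_prod[symmetric] by (intro sets_pair_measure_cong) auto
      fix x y :: real
      have "measure (distr M borel P \<Otimes>\<^sub>M distr M borel Q) ({..x} \<times> {..y}) = measure (distr M borel P) {..x} * measure (distr M borel Q) {..y}"
        by (simp add: measure_def Q.emeasure_pair_measure_Times enn2real_mult)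
      also have "\<dots> = prob {\<omega> \<in> space M. P \<omega> \<le> x} * prob {\<omega> \<in> space M. Q \<omega> \<le> y}"
        by (simp add: measure_distr vimage_def Int_def conj_commute)
      finally show "measure (distr M borel P \<Otimes>\<^sub>M distr M borel Q) ({..x} \<times> {..y})
          = measure (distr M borel (\<lambda>\<omega>. (P \<omega>, Q \<omega>))) ({..x} \<times> {..y})"
        using eq by (simp add: measure_joint_law)
    qed simp
    then show "indep_var borel P borel Q"
      unfolding indep_var_distribution_eq by (simp add: borel_prod)
  qed
qed

text \<open>
Composition with Borel functions preserves independence; the joint distribution function does not
see the null sets on which the variables differ from the compositions.
\<close>

lemma indep_var_completely_dependent:
  assumes M: "prob_space M" and ind: "prob_space.indep_var M borel X borel Y"
    and X': "X' \<in> borel_measurable M" "completely_dependent_on M X' X"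
    and Y': "Y' \<in> borel_measurable M" "completely_dependent_on M Y' Y"
  shows "prob_space.indep_var M borel X' borel Y'"
proof -
  interpret prob_space M by fact
  have [measurable]: "X \<in> borel_measurable M" "Y \<in> borel_measurable M"
    using ind unfolding indep_var_distribution_eq by auto
  note [measurable] = X'(1) Y'(1)
  obtain f where f [measurable]: "f \<in> borel_measurable borel" and fX: "AE \<omega> in M. X' \<omega> = f (X \<omega>)"
    using X' by (auto simp: completely_dependent_on_def)
  obtain g where g [measurable]: "g \<in> borel_measurable borel" and gY: "AE \<omega> in M. Y' \<omega> = g (Y \<omega>)"
    using Y' by (auto simp: completely_dependent_on_def)
  have i: "indep_var borel (\<lambda>\<omega>. f (X \<omega>)) borel (\<lambda>\<omega>. g (Y \<omega>))"
    using indep_var_compose[OF ind f g] by (simp add: o_def)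
  have 1: "prob {\<omega> \<in> space M. X' \<omega> \<le> x \<and> Y' \<omega> \<le> y} = prob {\<omega> \<in> space M. f (X \<omega>) \<le> x \<and> g (Y \<omega>) \<le> y}"
    and 2: "prob {\<omega> \<in> space M. X' \<omega> \<le> x} = prob {\<omega> \<in> space M. f (X \<omega>) \<le> x}"
    and 3: "prob {\<omega> \<in> space M. Y' \<omega> \<le> y} = prob {\<omega> \<in> space M. g (Y \<omega>) \<le> y}" for x y
    using fX gY by (auto intro!: finite_measure_eq_AE elim: eventually_elim2)
  show ?thesis
    using i by (simp add: indep_var_iff_joint_cdf[OF M] 1 2 3)
qed

lemma uniform_pair_indep_iff:
  assumes M: "prob_space M" and PQ: "uniform_pair M P Q C"
  shows "prob_space.indep_var M borel P borel Q \<longleftrightarrow> copula_eq C indep_copula"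
proof -
  have P: "uniform_rv M P" and Q: "uniform_rv M Q" using PQ by (auto simp: uniform_pair_def)
  then have m: "P \<in> borel_measurable M" "Q \<in> borel_measurable M" by (auto simp: uniform_rv_def)
  have cl: "max 0 (min 1 x) = x" if "x \<in> {0..1}" for x :: real using that by auto
  have "(\<forall>x y. C (max 0 (min 1 x)) (max 0 (min 1 y)) = max 0 (min 1 x) * max 0 (min 1 y))
    \<longleftrightarrow> copula_eq C indep_copula"
    unfolding copula_eq_def indep_copula_def
  proof (intro iffI ballI allI)
    fix x y :: real
    assume *: "\<forall>x y. C (max 0 (min 1 x)) (max 0 (min 1 y)) = max 0 (min 1 x) * max 0 (min 1 y)"
      and xy: "x \<in> {0..1}" "y \<in> {0..1}"
    from *[rule_format, of x y] show "C x y = x * y" unfolding cl[OF xy(1)] cl[OF xy(2)] .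
  qed auto
  then show ?thesis
    unfolding indep_var_iff_joint_cdf[OF M m] uniform_pair_joint_cdf[OF M PQ]
      uniform_rv_prob_le[OF P] uniform_rv_prob_le[OF Q] .
qed

text \<open>
A functional relation says that the joint law is carried by the graph of \<open>h\<close>, which is a property of
the copula.
\<close>

lemma uniform_pair_functional_dependence_transfer:
  assumes M: "prob_space M" "uniform_pair M P Q C" and N: "prob_space N" "uniform_pair N P' Q' C"
    and h: "h \<in> borel_measurable borel" and ae: "AE \<omega> in N. Q' \<omega> = h (P' \<omega>)"
  shows "AE \<omega> in M. Q \<omega> = h (P \<omega>)"
proof -
  note [measurable] = h
  have m: "P \<in> borel_measurable M" "Q \<in> borel_measurable M" "P' \<in> borel_measurable N" "Q' \<in> borel_measurable N"
    using M N by (auto simp: uniform_pair_def uniform_rv_def)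
  have law: "distr M borel (\<lambda>\<omega>. (P \<omega>, Q \<omega>)) = distr N borel (\<lambda>\<omega>. (P' \<omega>, Q' \<omega>))"
    by (rule uniform_pair_joint_law[OF M N]) (simp add: copula_eq_def)
  have "{p \<in> space (borel \<Otimes>\<^sub>M borel). snd p = h (fst p)} \<in> sets (borel \<Otimes>\<^sub>M borel)" by measurable
  then have S: "{p::real \<times> real. snd p = h (fst p)} \<in> sets borel"
    unfolding borel_prod[symmetric] by (simp add: space_pair_measure)
  have "AE p in distr N borel (\<lambda>\<omega>. (P' \<omega>, Q' \<omega>)). snd p = h (fst p)"
    using S ae measurable_Pair_borel[OF m(3,4)] by (subst AE_distr_iff) auto
  then show ?thesis
    unfolding law[symmetric] using S measurable_Pair_borel[OF m(1,2)] by (subst (asm) AE_distr_iff) auto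
qed

theorem lemma4p10:
  fixes M :: "'a measure" and X Y :: "'a \<Rightarrow> real" and C U V :: "real \<Rightarrow> real \<Rightarrow> real"
  assumes "prob_space M"
    and "continuous_rv M X" and "continuous_rv M Y"
    and "is_copula_of M X Y C"
    and "invertible_copula U" and "invertible_copula V"
  shows "(prob_space.indep_var M borel X borel Y
            \<longleftrightarrow> copula_eq (copula_S U V C) indep_copula) \<and>
         ((completely_dependent_on M X Y \<or> completely_dependent_on M Y X)
            \<longleftrightarrow> complete_dependence_copula (copula_S U V C)) \<and>
         (mutually_completely_dependent M X Y
            \<longleftrightarrow> mutual_complete_dependence_copula (copula_S U V C))"
proof -
  note M = assms(1) and X = assms(2) and Y = assms(3)
  obtain X' Y' where S: "uniform_pair M X' Y' (copula_S U V C)"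
    and dX: "completely_dependent_on M X' X" "completely_dependent_on M X X'"
    and dY: "completely_dependent_on M Y' Y" "completely_dependent_on M Y Y'"
    by (rule copula_S_representation[OF assms])
  have unif: "uniform_rv M X'" "uniform_rv M Y'" using S by (auto simp: uniform_pair_def)
  have X': "continuous_rv M X'" and Y': "continuous_rv M Y'"
    using unif by (auto intro: uniform_rv_continuous)
  have m: "X \<in> borel_measurable M" "Y \<in> borel_measurable M" "X' \<in> borel_measurable M" "Y' \<in> borel_measurable M"
    using X Y X' Y' by (auto simp: continuous_rv_def)
  have cop: "is_copula_of M X' Y' (copula_S U V C)" by (rule uniform_pair_is_copula_of[OF M S])

  have 1: "prob_space.indep_var M borel X borel Y \<longleftrightarrow> copula_eq (copula_S U V C) indep_copula"
    unfolding uniform_pair_indep_iff[OF M S, symmetric]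
    using indep_var_completely_dependent[OF M _ m(3) dX(1) m(4) dY(1)]
      indep_var_completely_dependent[OF M _ m(1) dX(2) m(2) dY(2)] by blast

  have "completely_dependent_on M X' Y' \<or> completely_dependent_on M Y' X'"
    if cd: "complete_dependence_copula (copula_S U V C)"
  proof -
    obtain N :: "(real \<times> real) measure" and P Q where N: "prob_space N" "continuous_rv N P" "continuous_rv N Q"
      "is_copula_of N P Q (copula_S U V C)" and dep: "completely_dependent_on N P Q \<or> completely_dependent_on N Q P"
      using cd unfolding complete_dependence_copula_def by blast
    \<comment> \<open>The pair \<open>(P', Q')\<close> has the same joint law as \<open>(X', Y')\<close>.\<close>
    define P' where "P' \<omega> = cdf (distr N borel P) (P \<omega>)" for \<omega>
    define Q' where "Q' \<omega> = cdf (distr N borel Q) (Q \<omega>)" for \<omega>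
    have PQ': "uniform_pair N P' Q' (copula_S U V C)"
      using uniform_pair_cdf_transform[OF N] by (simp add: P'_def[abs_def] Q'_def[abs_def])
    have dP: "completely_dependent_on N P' P" "completely_dependent_on N P P'"
      and dQ: "completely_dependent_on N Q' Q" "completely_dependent_on N Q Q'"
      using completely_dependent_cdf_transform[OF N(1,2)] completely_dependent_cdf_transform[OF N(1,3)]
      by (simp_all add: P'_def[abs_def] Q'_def[abs_def])
    from dep show ?thesis
    proof
      assume "completely_dependent_on N P Q"
      then have "completely_dependent_on N P' Q'"
        using dP dQ completely_dependent_on_trans by blast
      then have "completely_dependent_on M X' Y'"
        unfolding completely_dependent_on_def
        using uniform_pair_functional_dependence_transfer[OF M uniform_pair_transpose[OF S] N(1) uniform_pair_transpose[OF PQ']] by blast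
      then show ?thesis ..
    next
      assume "completely_dependent_on N Q P"
      then have "completely_dependent_on N Q' P'"
        using dP dQ completely_dependent_on_trans by blast
      then have "completely_dependent_on M Y' X'"
        unfolding completely_dependent_on_def using uniform_pair_functional_dependence_transfer[OF M S N(1) PQ'] by blast
      then show ?thesis ..
    qed
  qed
  moreover have "(completely_dependent_on M X Y \<or> completely_dependent_on M Y X) \<longleftrightarrow>
      (completely_dependent_on M X' Y' \<or> completely_dependent_on M Y' X')"
    using dX dY completely_dependent_on_trans by metis
  ultimately have 2: "(completely_dependent_on M X Y \<or> completely_dependent_on M Y X)
      \<longleftrightarrow> complete_dependence_copula (copula_S U V C)"
    using complete_dependence_copulaI[OF M X' Y' cop] by blast

  have "mutually_completely_dependent M X' Y'"
    if mcd: "mutual_complete_dependence_copula (copula_S U V C)"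
  proof -
    obtain N :: "(real \<times> real) measure" and P Q where N: "prob_space N" "continuous_rv N P" "continuous_rv N Q"
      "is_copula_of N P Q (copula_S U V C)" and dep: "mutually_completely_dependent N P Q"
      using mcd unfolding mutual_complete_dependence_copula_def by blast
    define P' where "P' \<omega> = cdf (distr N borel P) (P \<omega>)" for \<omega>
    define Q' where "Q' \<omega> = cdf (distr N borel Q) (Q \<omega>)" for \<omega>
    have PQ': "uniform_pair N P' Q' (copula_S U V C)"
      using uniform_pair_cdf_transform[OF N] by (simp add: P'_def[abs_def] Q'_def[abs_def])
    then have cont: "continuous_rv N P'" "continuous_rv N Q'"
      by (auto simp: uniform_pair_def intro: uniform_rv_continuous)
    have "completely_dependent_on N P' P" "completely_dependent_on N P P'"
      "completely_dependent_on N Q' Q" "completely_dependent_on N Q Q'"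
      using completely_dependent_cdf_transform[OF N(1,2)] completely_dependent_cdf_transform[OF N(1,3)]
      by (simp_all add: P'_def[abs_def] Q'_def[abs_def])
    then have "mutually_completely_dependent N P' P" "mutually_completely_dependent N Q Q'"
      using N cont by (auto intro: mutually_completely_dependentI)
    then have "mutually_completely_dependent N P' Q'"
      using dep mutually_completely_dependent_trans by blast
    then show ?thesis
      unfolding mutually_completely_dependent_def using uniform_pair_functional_dependence_transfer[OF M S N(1) PQ'] by blast
  qed
  moreover have "mutually_completely_dependent M X X'" "mutually_completely_dependent M X' X"
    "mutually_completely_dependent M Y Y'" "mutually_completely_dependent M Y' Y"
    using M X Y X' Y' dX dY by (auto intro: mutually_completely_dependentI)
  then have "mutually_completely_dependent M X Y \<longleftrightarrow> mutually_completely_dependent M X' Y'"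
    using mutually_completely_dependent_trans by metis
  ultimately have 3: "mutually_completely_dependent M X Y
      \<longleftrightarrow> mutual_complete_dependence_copula (copula_S U V C)"
    using mutual_complete_dependence_copulaI[OF M X' Y' cop] by blast
  show ?thesis using 1 2 3 by blast
qed

end
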